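(* Let $M$ be an $8$-manifold with a $\mathrm{Spin}(7)$-structure $\Phi$, and let $(x^1,\dots,x^8)$ be $\mathrm{Spin}(7)$-adapted Riemannian normal coordinates centred at $x\in M$. The components $\Phi_{ijkl}$ of $\Phi$ have Taylor expansion about $0\in\mathbb R^8$ (corresponding to $x$) given by $$\Phi_{ijkl}(x^1,\dots,x^8)=\Phi_{ijkl}+\left(T_{q;im}\Phi_{mjkl}+T_{q;jm}\Phi_{imkl}+T_{q;km}\Phi_{ijml}+T_{q;lm}\Phi_{ijkm}\right)x^q+Q_{pqijkl}x^px^q+O(\|x\|^3),$$ where $$\begin{aligned}Q_{pqijkl}={}&\tfrac12\left(\nabla_pT_{q;im}\Phi_{mjkl}+\nabla_pT_{q;jm}\Phi_{imkl}+\nabla_pT_{q;km}\Phi_{ijml}+\nabla_pT_{q;lm}\Phi_{ijkm}\right)\\&+\tfrac12T_{q;im}\left(T_{p;ms}\Phi_{sjkl}+T_{p;js}\Phi_{mskl}+T_{p;ks}\Phi_{mjsl}+T_{p;ls}\Phi_{mjks}\right)\\&+\tfrac12T_{q;jm}\left(T_{p;is}\Phi_{smkl}+T_{p;ms}\Phi_{iskl}+T_{p;ks}\Phi_{imsl}+T_{p;ls}\Phi_{imks}\right)\\&+\tfrac12T_{q;km}\left(T_{p;is}\Phi_{sjml}+T_{p;js}\Phi_{isml}+T_{p;ms}\Phi_{ijsl}+T_{p;ls}\Phi_{ijms}\right)\\&+\tfrac12T_{q;lm}\left(T_{p;is}\Phi_{sjkm}+T_{p;js}\Phi_{iskm}+T_{p;ks}\Phi_{ijsm}+T_{p;ms}\Phi_{ijks}\right)\\&+\tfrac16\left(R_{piqm}\Phi_{mjkl}+R_{pjqm}\Phi_{imkl}+R_{pkqm}\Phi_{ijml}+R_{plqm}\Phi_{ijkm}\right),\end{aligned}$$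 and all coefficient tensors on the right-hand sides are evaluated at $0$.
   Context: A $\mathrm{Spin}(7)$-structure on an $8$-manifold $M$ is a $4$-form $\Phi$ which at each point agrees, in a suitable basis of the tangent space, with the standard $\mathrm{Spin}(7)$-invariant (Cayley) $4$-form on $\mathbb R^8$; it determines a Riemannian metric $g$ and an orientation. $\nabla$ is the Levi-Civita connection of $g$. Repeated indices are summed from $1$ to $8$. The torsion $T_{m;ab}$ of $\Phi$ is skew in $a,b$, for each fixed $m$ lies in the $7$-dimensional summand $\Omega^2_7$ of $\Omega^2=\Omega^2_7\oplus\Omega^2_{21}$, and is determined by $\nabla_m\Phi_{ijkl}=T_{m;ip}\Phi_{pjkl}+T_{m;jp}\Phi_{ipkl}+T_{m;kp}\Phi_{ijpl}+T_{m;lp}\Phi_{ijkp}$; equivalently $T_{m;ab}=\frac1{96}(\nabla_m\Phi_{ajkl})\Phi_{bjkl}$. (The semicolon does not denote differentiation; $\nabla_pT_{q;im}$ is the covariant derivative of $T$.) The Riemann tensor convention is fixed by the Ricci identity $\nabla_i\nabla_jS_{kl}-\nabla_j\nabla_iS_{kl}=-R_{ijkm}S_{ml}-R_{ijlm}S_{km}$. $\mathrm{Spin}(7)$-adapted Riemannian normal coordinates at $x$ are Riemannian normal coordinates built from an orthonormal frame of $T_xM$ in which the components $\Phi_{ijkl}$ at $x$ agree with those of the standard flat model on $\mathbb R^8$. *)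

theory Defs
  imports "HOL-Analysis.Analysis" "HOL-Library.Landau_Symbols"
begin

section \<open>Smooth functions on open subsets of $R^8$\<close>

definition pd :: "8 \<Rightarrow> (real^8 \<Rightarrow> real) \<Rightarrow> real^8 \<Rightarrow> real" where
  "pd i f v = frechet_derivative f (at v) (axis i 1)"

fun Ck_on :: "nat \<Rightarrow> (real^8) set \<Rightarrow> (real^8 \<Rightarrow> real) \<Rightarrow> bool" where
  "Ck_on 0 U f \<longleftrightarrow> continuous_on U f"
| "Ck_on (Suc k) U f \<longleftrightarrow> f differentiable_on U \<and> (\<forall>i. Ck_on k U (pd i f))"

text \<open>Only used for open sets.\<close>

definition smooth_on :: "(real^8) set \<Rightarrow> (real^8 \<Rightarrow> real) \<Rightarrow> bool" where
  "smooth_on U f \<longleftrightarrow> (\<forall>k. Ck_on k U f)"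


section \<open>Smooth 8-manifolds\<close>

text \<open>
  The manifold $M$ is the universe of a second countable Hausdorff type, with a maximal
  smooth atlas \<open>A\<close>. A chart is a pair of its domain and its coordinate map; the values of
  the coordinate map outside the domain are irrelevant.
\<close>

type_synonym 'm chart = "'m set \<times> ('m \<Rightarrow> real^8)"

definition inv_chart :: "'m chart \<Rightarrow> real^8 \<Rightarrow> 'm" where
  "inv_chart c = inv_into (fst c) (snd c)"

definition img :: "'m chart \<Rightarrow> (real^8) set" where
  "img c = snd c ` fst c"

definition is_chart :: "'m::topological_space chart \<Rightarrow> bool" where
  "is_chart c \<longleftrightarrow> open (fst c) \<and> open (img c) \<and>
     homeomorphism (fst c) (img c) (snd c) (inv_chart c)"

definition transition :: "'m chart \<Rightarrow> 'm chart \<Rightarrow> real^8 \<Rightarrow> real^8" where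
  "transition c c' = snd c' \<circ> inv_chart c"

definition compatible :: "'m chart \<Rightarrow> 'm chart \<Rightarrow> bool" where
  "compatible c c' \<longleftrightarrow>
     (\<forall>i. smooth_on (snd c ` (fst c \<inter> fst c')) (\<lambda>v. transition c c' v $ i))"

definition smooth_structure :: "'m::{t2_space, second_countable_topology} chart set \<Rightarrow> bool" where
  "smooth_structure A \<longleftrightarrow>
     (\<forall>c\<in>A. is_chart c) \<and> (\<Union>c\<in>A. fst c) = UNIV \<and>
     (\<forall>c\<in>A. \<forall>c'\<in>A. compatible c c') \<and>
     (\<forall>c. is_chart c \<and> (\<forall>c'\<in>A. compatible c c' \<and> compatible c' c) \<longrightarrow> c \<in> A)"


section \<open>Tangent spaces and covariant tensor fields\<close>

text \<open>
  A tangent vector at \<open>p\<close> is given by its components in all charts around \<open>p\<close>, related by the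
  differentials of the transition maps. The value is 0 at charts that do not contain \<open>p\<close>, so
  that tangent vectors are equal iff their components agree.
\<close>

type_synonym 'm tvec = "'m chart \<Rightarrow> real^8"

definition tangent_space :: "'m chart set \<Rightarrow> 'm \<Rightarrow> 'm tvec set" where
  "tangent_space A p = {u.
     (\<forall>c\<in>A. \<forall>c'\<in>A. p \<in> fst c \<and> p \<in> fst c' \<longrightarrow>
        u c' = frechet_derivative (transition c c') (at (snd c p)) (u c)) \<and>
     (\<forall>c. \<not> (c \<in> A \<and> p \<in> fst c) \<longrightarrow> u c = 0)}"

definition lincomb :: "(8 \<Rightarrow> 'm tvec) \<Rightarrow> real^8 \<Rightarrow> 'm tvec" where
  "lincomb e a = (\<lambda>c. \<Sum>i\<in>UNIV. (a $ i) *\<^sub>R e i c)"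

definition is_frame :: "'m chart set \<Rightarrow> 'm \<Rightarrow> (8 \<Rightarrow> 'm tvec) \<Rightarrow> bool" where
  "is_frame A p e \<longleftrightarrow> (\<forall>i. e i \<in> tangent_space A p) \<and>
     (\<forall>u\<in>tangent_space A p. \<exists>!a. u = lincomb e a)"

text \<open>The coordinate vector $\partial_i$ at \<open>p\<close> of the chart \<open>c\<close>.\<close>

definition coord_vec :: "'m chart set \<Rightarrow> 'm chart \<Rightarrow> 'm \<Rightarrow> 8 \<Rightarrow> 'm tvec" where
  "coord_vec A c p i = (\<lambda>c'. if c' \<in> A \<and> p \<in> fst c'
     then frechet_derivative (transition c c') (at (snd c p)) (axis i 1) else 0)"

text \<open>A covariant tensor field of rank \<open>r\<close> takes a point \<open>p\<close> and a list of \<open>r\<close> tangent vectors at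
  \<open>p\<close>. Its components in a chart are functions on the image of that chart, indexed by lists of
  length \<open>r\<close>.\<close>

type_synonym 'm tensor = "'m \<Rightarrow> 'm tvec list \<Rightarrow> real"

definition tcomp :: "'m chart set \<Rightarrow> 'm tensor \<Rightarrow> 'm chart \<Rightarrow> 8 list \<Rightarrow> real^8 \<Rightarrow> real" where
  "tcomp A \<tau> c I v = \<tau> (inv_chart c v) (map (coord_vec A c (inv_chart c v)) I)"

definition multilinear :: "'m chart set \<Rightarrow> nat \<Rightarrow> 'm tensor \<Rightarrow> bool" where
  "multilinear A r \<tau> \<longleftrightarrow>
     (\<forall>p us k u w a b. length us = r \<and> set us \<subseteq> tangent_space A p \<and> k < r \<and>
        u \<in> tangent_space A p \<and> w \<in> tangent_space A p \<longrightarrow>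
        \<tau> p (us[k := (\<lambda>c. a *\<^sub>R u c + b *\<^sub>R w c)]) = a * \<tau> p (us[k := u]) + b * \<tau> p (us[k := w]))"

definition tensor_field :: "'m chart set \<Rightarrow> nat \<Rightarrow> 'm tensor \<Rightarrow> bool" where
  "tensor_field A r \<tau> \<longleftrightarrow> multilinear A r \<tau> \<and>
     (\<forall>c\<in>A. \<forall>I. length I = r \<longrightarrow> smooth_on (img c) (tcomp A \<tau> c I))"

definition differential_form :: "'m chart set \<Rightarrow> nat \<Rightarrow> 'm tensor \<Rightarrow> bool" where
  "differential_form A r \<tau> \<longleftrightarrow> tensor_field A r \<tau> \<and>
     (\<forall>p us a b. length us = r \<and> set us \<subseteq> tangent_space A p \<and> a < b \<and> b < r \<and> us ! a = us ! b
        \<longrightarrow> \<tau> p us = 0)"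


section \<open>Riemannian geometry\<close>

definition riemannian_metric :: "'m chart set \<Rightarrow> 'm tensor \<Rightarrow> bool" where
  "riemannian_metric A g \<longleftrightarrow> tensor_field A 2 g \<and>
     (\<forall>p. \<forall>u\<in>tangent_space A p. \<forall>w\<in>tangent_space A p. g p [u, w] = g p [w, u]) \<and>
     (\<forall>p. \<forall>u\<in>tangent_space A p. u \<noteq> (\<lambda>c. 0) \<longrightarrow> g p [u, u] > 0)"

definition orthonormal_frame :: "'m chart set \<Rightarrow> 'm tensor \<Rightarrow> 'm \<Rightarrow> (8 \<Rightarrow> 'm tvec) \<Rightarrow> bool" where
  "orthonormal_frame A g p e \<longleftrightarrow> is_frame A p e \<and>
     (\<forall>i j. g p [e i, e j] = (if i = j then 1 else 0))"

text \<open>The components $g^{ij}$ of the inverse metric.\<close>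

definition ginv :: "'m chart set \<Rightarrow> 'm tensor \<Rightarrow> 'm chart \<Rightarrow> 8 \<Rightarrow> 8 \<Rightarrow> real^8 \<Rightarrow> real" where
  "ginv A g c i j v = matrix_inv (\<chi> a b. tcomp A g c [a, b] v) $ i $ j"

text \<open>The Christoffel symbols $\Gamma^k_{ij}$ of the Levi-Civita connection.\<close>

definition christoffel ::
    "'m chart set \<Rightarrow> 'm tensor \<Rightarrow> 'm chart \<Rightarrow> 8 \<Rightarrow> 8 \<Rightarrow> 8 \<Rightarrow> real^8 \<Rightarrow> real" where
  "christoffel A g c k i j v = 1/2 * (\<Sum>l\<in>UNIV. ginv A g c k l v *
     (pd i (tcomp A g c [j, l]) v + pd j (tcomp A g c [i, l]) v - pd l (tcomp A g c [i, j]) v))"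

text \<open>The component $(\nabla_m S)_I$ of the covariant derivative, where \<open>S\<close> gives the components
  of a covariant tensor field in the chart \<open>c\<close>.\<close>

definition cov_deriv ::
    "'m chart set \<Rightarrow> 'm tensor \<Rightarrow> 'm chart \<Rightarrow> (8 list \<Rightarrow> real^8 \<Rightarrow> real) \<Rightarrow> 8 \<Rightarrow> 8 list \<Rightarrow> real^8 \<Rightarrow> real"
  where
  "cov_deriv A g c S m I v = pd m (S I) v -
     (\<Sum>k<length I. \<Sum>s\<in>UNIV. christoffel A g c s m (I ! k) v * S (I[k := s]) v)"

text \<open>
  The convention for $R_{ijkl}$ is the one for which
  $\nabla_i \nabla_j \alpha_k - \nabla_j \nabla_i \alpha_k = - R_{ijk}{}^m \alpha_m$
  for a covector $\alpha$, that is,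
  $R(\partial_i, \partial_j) \partial_k = R_{ijk}{}^m \partial_m$ with
  $R(X,Y) = [\nabla_X, \nabla_Y] - \nabla_{[X,Y]}$, the upper index being lowered into the
  fourth position.
\<close>

definition riemann_up ::
    "'m chart set \<Rightarrow> 'm tensor \<Rightarrow> 'm chart \<Rightarrow> 8 \<Rightarrow> 8 \<Rightarrow> 8 \<Rightarrow> 8 \<Rightarrow> real^8 \<Rightarrow> real" where
  "riemann_up A g c i j k m v =
     pd i (christoffel A g c m j k) v - pd j (christoffel A g c m i k) v +
     (\<Sum>s\<in>UNIV. christoffel A g c m i s v * christoffel A g c s j k v
             - christoffel A g c m j s v * christoffel A g c s i k v)"

definition riemann ::
    "'m chart set \<Rightarrow> 'm tensor \<Rightarrow> 'm chart \<Rightarrow> 8 \<Rightarrow> 8 \<Rightarrow> 8 \<Rightarrow> 8 \<Rightarrow> real^8 \<Rightarrow> real" where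
  "riemann A g c i j k l v = (\<Sum>m\<in>UNIV. riemann_up A g c i j k m v * tcomp A g c [m, l] v)"

text \<open>A geodesic \<open>\<gamma>\<close> defined on $[0,1]$ with velocity \<open>\<gamma>'\<close>.\<close>

definition geodesic ::
    "'m::topological_space chart set \<Rightarrow> 'm tensor \<Rightarrow> (real \<Rightarrow> 'm) \<Rightarrow> (real \<Rightarrow> 'm tvec) \<Rightarrow> bool" where
  "geodesic A g \<gamma> \<gamma>' \<longleftrightarrow> continuous_on {0..1} \<gamma> \<and>
     (\<forall>t\<in>{0..1}. \<gamma>' t \<in> tangent_space A (\<gamma> t)) \<and>
     (\<forall>t\<in>{0..1}. \<forall>c\<in>A. \<gamma> t \<in> fst c \<longrightarrow>
        ((\<lambda>s. snd c (\<gamma> s)) has_vector_derivative \<gamma>' t c) (at t within {0..1}) \<and>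
        ((\<lambda>s. \<gamma>' s c) has_vector_derivative
           (\<chi> k. - (\<Sum>i\<in>UNIV. \<Sum>j\<in>UNIV.
              christoffel A g c k i j (snd c (\<gamma> t)) * \<gamma>' t c $ i * \<gamma>' t c $ j)))
           (at t within {0..1}))"

text \<open>\<open>q = exp\<^sub>p u\<close>, as a relation since $\exp_p$ is only partially defined.\<close>

definition is_exp ::
    "'m::topological_space chart set \<Rightarrow> 'm tensor \<Rightarrow> 'm \<Rightarrow> 'm tvec \<Rightarrow> 'm \<Rightarrow> bool" where
  "is_exp A g p u q \<longleftrightarrow> (\<exists>\<gamma> \<gamma>'. geodesic A g \<gamma> \<gamma>' \<and> \<gamma> 0 = p \<and> \<gamma>' 0 = u \<and> \<gamma> 1 = q)"

definition normal_coordinates ::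
    "'m::topological_space chart set \<Rightarrow> 'm tensor \<Rightarrow> 'm \<Rightarrow> (8 \<Rightarrow> 'm tvec) \<Rightarrow> 'm chart \<Rightarrow> bool" where
  "normal_coordinates A g x e c \<longleftrightarrow> orthonormal_frame A g x e \<and>
     c \<in> A \<and> x \<in> fst c \<and> snd c x = 0 \<and>
     (\<forall>v\<in>img c. is_exp A g x (lincomb e v) (inv_chart c v))"


section \<open>Spin(7)-structures\<close>

text \<open>The components of $dx^a \wedge dx^b \wedge dx^c \wedge dx^d$.\<close>

definition dx4 :: "8 \<Rightarrow> 8 \<Rightarrow> 8 \<Rightarrow> 8 \<Rightarrow> 8 \<Rightarrow> 8 \<Rightarrow> 8 \<Rightarrow> 8 \<Rightarrow> real" where
  "dx4 a b c d i j k l =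
     det (\<chi> r s. if (vector [a, b, c, d] :: 8^4) $ r = (vector [i, j, k, l] :: 8^4) $ s
                 then 1 else 0 :: real^4^4)"

text \<open>
  The Cayley form in the convention for which
  $\Phi_{ijab} \Phi_{klab} = 6 \delta_{ik} \delta_{jl} - 6 \delta_{il} \delta_{jk} - 4 \Phi_{ijkl}$,
  the terms without $dx^8$ forming the Hodge dual in $R^7$ of the associative 3-form.
  In type \<open>8\<close> the index 8 is the same as 0.
\<close>

definition cayley :: "8 \<Rightarrow> 8 \<Rightarrow> 8 \<Rightarrow> 8 \<Rightarrow> real" where
  "cayley i j k l =
       dx4 8 1 2 3 i j k l - dx4 8 1 6 7 i j k l - dx4 8 5 2 7 i j k l - dx4 8 5 6 3 i j k l
     - dx4 8 4 1 5 i j k l - dx4 8 4 2 6 i j k l - dx4 8 4 3 7 i j k l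
     + dx4 4 5 6 7 i j k l - dx4 4 5 2 3 i j k l - dx4 4 1 6 3 i j k l - dx4 4 1 2 7 i j k l
     - dx4 2 6 3 7 i j k l - dx4 1 5 3 7 i j k l - dx4 1 5 2 6 i j k l"

definition adapted_frame :: "'m chart set \<Rightarrow> 'm tensor \<Rightarrow> 'm \<Rightarrow> (8 \<Rightarrow> 'm tvec) \<Rightarrow> bool" where
  "adapted_frame A \<Phi> p e \<longleftrightarrow> is_frame A p e \<and>
     (\<forall>i j k l. \<Phi> p [e i, e j, e k, e l] = cayley i j k l)"

definition spin7_structure :: "'m chart set \<Rightarrow> 'm tensor \<Rightarrow> bool" where
  "spin7_structure A \<Phi> \<longleftrightarrow> differential_form A 4 \<Phi> \<and> (\<forall>p. \<exists>e. adapted_frame A \<Phi> p e)"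

text \<open>\<open>g\<close> is the metric determined by \<open>\<Phi>\<close>. Since the stabilizer Spin(7) of the Cayley form
  lies in SO(8), all adapted frames at \<open>p\<close> are orthonormal as soon as one is, and \<open>g\<close> is unique.\<close>

definition spin7_metric :: "'m chart set \<Rightarrow> 'm tensor \<Rightarrow> 'm tensor \<Rightarrow> bool" where
  "spin7_metric A \<Phi> g \<longleftrightarrow> riemannian_metric A g \<and>
     (\<forall>p. \<exists>e. adapted_frame A \<Phi> p e \<and> orthonormal_frame A g p e)"

text \<open>The components \<open>\<omega>\<close> of a 2-form at the point with coordinates \<open>v\<close> lie in $\Omega^2_7$, that
  is, $*(\Phi \wedge \omega) = -3 \omega$. The operator $\omega_{ab} \mapsto \Phi_{abcd} \omega_{cd}$
  has eigenvalue $-6$ on $\Omega^2_7$ and 2 on $\Omega^2_{21}$.\<close>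

definition in_Omega27 ::
    "'m chart set \<Rightarrow> 'm tensor \<Rightarrow> 'm tensor \<Rightarrow> 'm chart \<Rightarrow> real^8 \<Rightarrow> (8 \<Rightarrow> 8 \<Rightarrow> real) \<Rightarrow> bool" where
  "in_Omega27 A \<Phi> g c v \<omega> \<longleftrightarrow> (\<forall>a b. \<omega> a b = - \<omega> b a) \<and>
     (\<forall>a b. (\<Sum>i\<in>UNIV. \<Sum>j\<in>UNIV. \<Sum>k\<in>UNIV. \<Sum>l\<in>UNIV.
        tcomp A \<Phi> c [a, b, i, j] v * ginv A g c i k v * ginv A g c j l v * \<omega> k l) = - 6 * \<omega> a b)"

text \<open>\<open>T\<close> is the torsion of \<open>\<Phi>\<close>; the component with indices \<open>[m, a, b]\<close> is $T_{m;ab}$. In an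
  arbitrary chart, the contractions of the defining equation use the inverse metric.\<close>

definition spin7_torsion :: "'m chart set \<Rightarrow> 'm tensor \<Rightarrow> 'm tensor \<Rightarrow> 'm tensor \<Rightarrow> bool" where
  "spin7_torsion A \<Phi> g T \<longleftrightarrow> tensor_field A 3 T \<and>
     (\<forall>c\<in>A. \<forall>v\<in>img c.
        (\<forall>m. in_Omega27 A \<Phi> g c v (\<lambda>a b. tcomp A T c [m, a, b] v)) \<and>
        (\<forall>m i j k l. cov_deriv A g c (tcomp A \<Phi> c) m [i, j, k, l] v =
           (\<Sum>p\<in>UNIV. \<Sum>q\<in>UNIV. ginv A g c p q v *
             (tcomp A T c [m, i, p] v * tcomp A \<Phi> c [q, j, k, l] v +
              tcomp A T c [m, j, p] v * tcomp A \<Phi> c [i, q, k, l] v +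
              tcomp A T c [m, k, p] v * tcomp A \<Phi> c [i, j, q, l] v +
              tcomp A T c [m, l, p] v * tcomp A \<Phi> c [i, j, k, q] v))))"

definition spin7_normal_coordinates ::
    "'m::topological_space chart set \<Rightarrow> 'm tensor \<Rightarrow> 'm tensor \<Rightarrow> 'm \<Rightarrow> 'm chart \<Rightarrow> bool" where
  "spin7_normal_coordinates A \<Phi> g x c \<longleftrightarrow>
     (\<exists>e. adapted_frame A \<Phi> x e \<and> normal_coordinates A g x e c)"

end

theory Submission
  imports Defs
begin

text \<open>In normal coordinates the curves $t \mapsto tv$ are geodesics for small $t$, so the
  Christoffel symbols satisfy $\Gamma^k_{ij}(tv)\, v_i v_j = 0$ there. The value at $t = 0$ gives
  $\Gamma(0) = 0$, because $\Gamma$ is symmetric in its lower indices; the derivative at $t = 0$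
  gives that the sum of $\partial_p \Gamma^m_{qi}(0)$ over the cyclic permutations of $p, q, i$
  is $0$. At the centre the curvature is
  $R_{piqm} = \partial_p \Gamma^m_{iq} - \partial_i \Gamma^m_{pq}$, and together with the cyclic
  identity this yields
  \[ \partial_p \Gamma^m_{qi}(0)\, v_p v_q = \tfrac13 R_{piqm}\, v_p v_q, \]
  which is lemma \<open>riemann_quadratic\<close>. Also the velocity of $t \mapsto tv$ at $0$ is $v$, so the
  coordinate frame at the centre is the given orthonormal frame and $g_{ij}(0) = \delta_{ij}$;
  since $\Gamma(0) = 0$, the first derivatives of $g$ and of its inverse vanish at $0$.

  Write $W \cdot F$ for the derivation action of a matrix $W$ on a tensor $F$ of rank 4. The
  defining equation of the torsion is $\nabla_q \Phi = T_q \cdot \Phi$, the contraction being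
  taken with the inverse metric. Evaluated at $0$ it gives the linear term
  $\partial_q \Phi = T_q \cdot \Phi$. Differentiated once more at $0$, where inverse metric and
  Christoffel symbols contribute only through $\partial \Gamma$, it gives
  \[ \partial_p \partial_q \Phi = \nabla_p T_q \cdot \Phi + T_q \cdot (T_p \cdot \Phi)
       + (\partial_p \Gamma^m_{qi}) \cdot \Phi, \]
  which is lemma \<open>pd_pd_form_0\<close>. Half of this, contracted with $v_p v_q$, is the quadratic Taylor
  term; the formula for $\partial \Gamma$ turns its last part into the curvature part with the
  factor $\frac12 \cdot \frac13 = \frac16$.

  What takes work is the statement about the curves $t \mapsto tv$. Normal coordinates only say
  that each point with coordinates $v$ is the end point of some geodesic with initial velocity
  $v$. That its earlier points have coordinates $tv$ follows by comparing it, run at speed $t$,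
  with the geodesic that ends at $tv$; so uniqueness of geodesics is needed. It is proved here in
  the form that a geodesic agrees with every solution of the geodesic equation in a chart that has
  the same initial position and velocity (lemma \<open>geodesic_determined_in_chart\<close>), from a local
  uniqueness theorem for ordinary differential equations with a locally Lipschitz right-hand side.\<close>

section \<open>Calculus of smooth functions\<close>

lemma pd_eqI:
  assumes "(f has_derivative D) (at v)" shows "pd i f v = D (axis i 1)"
  using frechet_derivative_at[OF assms] by (simp add: pd_def)

lemma has_derivative_pd:
  assumes "f differentiable (at v)"
  shows "(f has_derivative (\<lambda>h. \<Sum>i\<in>UNIV. h $ i * pd i f v)) (at v)"
proof -
  let ?D = "frechet_derivative f (at v)"
  have D: "(f has_derivative ?D) (at v)"
    using assms by (simp add: frechet_derivative_works)
  have "?D h = (\<Sum>i\<in>UNIV. h $ i * pd i f v)" for h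
  proof -
    have "?D h = ?D (\<Sum>i\<in>UNIV. (h $ i) *\<^sub>R axis i 1)"
      using basis_expansion[of h] by (simp add: scalar_mult_eq_scaleR)
    also have "\<dots> = (\<Sum>i\<in>UNIV. h $ i * pd i f v)"
      using has_derivative_linear[OF D] by (simp add: linear_sum linear_cmul pd_def)
    finally show ?thesis .
  qed
  then have "?D = (\<lambda>h. \<Sum>i\<in>UNIV. h $ i * pd i f v)" by blast
  then show ?thesis using D by simp
qed

lemma has_derivative_eq_on_open:
  fixes f f' :: "real^8 \<Rightarrow> real"
  assumes "open U" "v \<in> U" "\<And>u. u \<in> U \<Longrightarrow> f u = f' u"
  shows "(f has_derivative D) (at v) \<longleftrightarrow> (f' has_derivative D) (at v)"
  using has_derivative_transform_within_open[of f D v UNIV U f']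
    has_derivative_transform_within_open[of f' D v UNIV U f] assms by auto

lemma pd_cong_open:
  assumes "open U" "v \<in> U" "\<And>u. u \<in> U \<Longrightarrow> f u = f' u"
  shows "pd i f v = pd i f' v"
  by (simp add: pd_def frechet_derivative_def has_derivative_eq_on_open[OF assms])

lemma pd_const [simp]: "pd i (\<lambda>_. a) v = 0"
  by (rule pd_eqI[THEN trans]) (auto intro: has_derivative_const)

lemma pd_add:
  assumes "f differentiable (at v)" "f' differentiable (at v)"
  shows "pd i (\<lambda>u. f u + f' u) v = pd i f v + pd i f' v"
  by (simp add: pd_eqI[OF has_derivative_add[OF assms[unfolded frechet_derivative_works]]])
     (simp add: pd_def)

lemma pd_diff:
  assumes "f differentiable (at v)" "f' differentiable (at v)"
  shows "pd i (\<lambda>u. f u - f' u) v = pd i f v - pd i f' v"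
  by (simp add: pd_eqI[OF has_derivative_diff[OF assms[unfolded frechet_derivative_works]]])
     (simp add: pd_def)

lemma pd_mult:
  assumes "f differentiable (at v)" "f' differentiable (at v)"
  shows "pd i (\<lambda>u. f u * f' u) v = f v * pd i f' v + pd i f v * f' v"
  by (simp add: pd_eqI[OF has_derivative_mult[OF assms[unfolded frechet_derivative_works]]])
     (simp add: pd_def)

lemma pd_sum:
  assumes "finite I" "\<And>a. a \<in> I \<Longrightarrow> f a differentiable (at v)"
  shows "pd i (\<lambda>u. \<Sum>a\<in>I. f a u) v = (\<Sum>a\<in>I. pd i (f a) v)"
proof -
  have "((\<lambda>u. \<Sum>a\<in>I. f a u) has_derivative (\<lambda>h. \<Sum>a\<in>I. frechet_derivative (f a) (at v) h)) (at v)"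
    using assms(2) by (intro has_derivative_sum) (simp add: frechet_derivative_works)
  from pd_eqI[OF this] show ?thesis by (simp add: pd_def)
qed

lemma pd_inverse:
  assumes "f differentiable (at v)" "f v \<noteq> 0"
  shows "pd i (\<lambda>u. inverse (f u)) v = - (inverse (f v) * pd i f v * inverse (f v))"
  by (simp add: pd_eqI[OF Deriv.has_derivative_inverse[OF assms(2) assms(1)[unfolded frechet_derivative_works]]])
     (simp add: pd_def)

lemma Ck_on_Suc_imp: "Ck_on (Suc k) U f \<Longrightarrow> Ck_on k U f"
  by (induction k arbitrary: f) (auto intro: differentiable_imp_continuous_on)

lemma Ck_on_cong:
  assumes "open U" "\<And>u. u \<in> U \<Longrightarrow> f u = f' u" "Ck_on k U f"
  shows "Ck_on k U f'"
  using assms(2,3)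
proof (induction k arbitrary: f f')
  case 0
  then show ?case by (simp cong: continuous_on_cong)
next
  case (Suc k)
  have "Ck_on k U (pd i f')" for i
  proof (rule Suc.IH)
    show "pd i f u = pd i f' u" if "u \<in> U" for u
      using assms(1) that Suc.prems(1) by (rule pd_cong_open)
    show "Ck_on k U (pd i f)" using Suc.prems(2) by simp
  qed
  moreover have "f' differentiable (at u)" if "u \<in> U" for u
  proof -
    have "f differentiable (at u)"
      using Suc.prems(2) that by (simp add: differentiable_on_eq_differentiable_at[OF assms(1)])
    then obtain D where "(f has_derivative D) (at u)" by (auto simp: differentiable_def)
    then have "(f' has_derivative D) (at u)"
      using has_derivative_eq_on_open[OF assms(1) that, of f f' D] Suc.prems(1) by blast
    then show ?thesis by (auto simp: differentiable_def)
  qed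
  ultimately show ?case by (simp add: differentiable_on_eq_differentiable_at[OF assms(1)])
qed

lemma Ck_on_const: "Ck_on k U (\<lambda>_. a)"
proof (induction k arbitrary: a)
  case (Suc k)
  have "pd i (\<lambda>_. a) = (\<lambda>_. 0)" for i by auto
  then show ?case using Suc by simp
qed simp

lemma Ck_on_add:
  assumes "open U" "Ck_on k U f" "Ck_on k U f'"
  shows "Ck_on k U (\<lambda>u. f u + f' u)"
  using assms(2,3)
proof (induction k arbitrary: f f')
  case (Suc k)
  have "Ck_on k U (pd i (\<lambda>u. f u + f' u))" for i
    by (rule Ck_on_cong[OF assms(1) _ Suc.IH[of "pd i f" "pd i f'"]])
       (use Suc.prems assms(1) in \<open>auto simp: pd_add differentiable_on_eq_differentiable_at\<close>)
  then show ?case using Suc.prems by simp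
qed (auto intro: continuous_intros)

lemma Ck_on_mult:
  assumes "open U" "Ck_on k U f" "Ck_on k U f'"
  shows "Ck_on k U (\<lambda>u. f u * f' u)"
  using assms(2,3)
proof (induction k arbitrary: f f')
  case (Suc k)
  have "Ck_on k U (pd i (\<lambda>u. f u * f' u))" for i
    by (rule Ck_on_cong[OF assms(1) _ Ck_on_add[OF assms(1) Suc.IH[of f "pd i f'"] Suc.IH[of "pd i f" f']]])
       (use Suc.prems assms(1) Ck_on_Suc_imp in \<open>auto simp: pd_mult differentiable_on_eq_differentiable_at\<close>)
  then show ?case using Suc.prems by (simp add: differentiable_on_mult)
qed (auto intro: continuous_intros)

lemma Ck_on_inverse:
  assumes "open U" "Ck_on k U f" "\<And>u. u \<in> U \<Longrightarrow> f u \<noteq> 0"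
  shows "Ck_on k U (\<lambda>u. inverse (f u))"
  using assms(2,3)
proof (induction k arbitrary: f)
  case (Suc k)
  have "Ck_on k U (pd i (\<lambda>u. inverse (f u)))" for i
  proof (rule Ck_on_cong[OF assms(1)])
    let ?d = "\<lambda>u. - 1 * (inverse (f u) * pd i f u * inverse (f u))"
    show "?d u = pd i (\<lambda>u. inverse (f u)) u" if "u \<in> U" for u
      using that Suc.prems assms(1)
      by (simp add: pd_inverse differentiable_on_eq_differentiable_at)
    have "Ck_on k U f" "Ck_on k U (pd i f)" using Suc.prems Ck_on_Suc_imp by auto
    then show "Ck_on k U ?d"
      using Suc by (intro Ck_on_mult Ck_on_const assms(1)) auto
  qed
  moreover have "(\<lambda>u. inverse (f u)) differentiable_on U"
    using Suc.prems by (auto simp: differentiable_on_def intro: Deriv.differentiable_inverse)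
  ultimately show ?case by simp
qed (auto intro: continuous_intros)

lemma smooth_on_imp_continuous_on: "smooth_on U f \<Longrightarrow> continuous_on U f"
  unfolding smooth_on_def by (drule spec[of _ 0]) simp

lemma smooth_on_imp_differentiable:
  "smooth_on U f \<Longrightarrow> open U \<Longrightarrow> v \<in> U \<Longrightarrow> f differentiable (at v)"
  unfolding smooth_on_def
  by (drule spec[of _ "Suc 0"]) (simp add: differentiable_on_eq_differentiable_at)

lemma smooth_on_pd:
  assumes "smooth_on U f" shows "smooth_on U (pd i f)"
  unfolding smooth_on_def
proof
  fix k
  have "Ck_on (Suc k) U f" using assms unfolding smooth_on_def by blast
  then show "Ck_on k U (pd i f)" by simp
qed

lemma smooth_on_const: "smooth_on U (\<lambda>_. a)"
  by (simp add: smooth_on_def Ck_on_const)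

lemma smooth_on_add:
  "open U \<Longrightarrow> smooth_on U f \<Longrightarrow> smooth_on U f' \<Longrightarrow> smooth_on U (\<lambda>u. f u + f' u)"
  by (simp add: smooth_on_def Ck_on_add)

lemma smooth_on_mult:
  "open U \<Longrightarrow> smooth_on U f \<Longrightarrow> smooth_on U f' \<Longrightarrow> smooth_on U (\<lambda>u. f u * f' u)"
  by (simp add: smooth_on_def Ck_on_mult)

lemma smooth_on_diff:
  assumes "open U" "smooth_on U f" "smooth_on U f'" shows "smooth_on U (\<lambda>u. f u - f' u)"
  using smooth_on_add[OF assms(1,2) smooth_on_mult[OF assms(1) smooth_on_const[of U "-1"] assms(3)]]
  by simp

lemma smooth_on_divide:
  assumes "open U" "smooth_on U f" "smooth_on U f'" "\<And>u. u \<in> U \<Longrightarrow> f' u \<noteq> 0"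
  shows "smooth_on U (\<lambda>u. f u / f' u)"
  unfolding divide_inverse using assms
  by (intro smooth_on_mult) (auto simp: smooth_on_def Ck_on_inverse)

lemma smooth_on_sum:
  assumes "open U" "finite I" "\<And>a. a \<in> I \<Longrightarrow> smooth_on U (f a)"
  shows "smooth_on U (\<lambda>u. \<Sum>a\<in>I. f a u)"
  using assms(2,3) by (induction I rule: finite_induct) (auto intro: smooth_on_add smooth_on_const assms(1))

lemma smooth_on_prod:
  assumes "open U" "finite I" "\<And>a. a \<in> I \<Longrightarrow> smooth_on U (f a)"
  shows "smooth_on U (\<lambda>u. \<Prod>a\<in>I. f a u)"
  using assms(2,3) by (induction I rule: finite_induct) (auto intro: smooth_on_mult smooth_on_const assms(1))

lemma smooth_on_cong:
  assumes "open U" "\<And>u. u \<in> U \<Longrightarrow> f u = f' u" "smooth_on U f"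
  shows "smooth_on U f'"
  using assms(3) unfolding smooth_on_def by (auto intro: Ck_on_cong[OF assms(1,2)])

lemma smooth_on_det:
  fixes M :: "real^8 \<Rightarrow> real^8^8"
  assumes "open U" "\<And>i j. smooth_on U (\<lambda>u. M u $ i $ j)"
  shows "smooth_on U (\<lambda>u. det (M u))"
  unfolding det_def using assms
  by (intro smooth_on_sum smooth_on_mult smooth_on_prod smooth_on_const) (auto simp: finite_permutations)

lemma matrix_inv_right:
  fixes M :: "real^'n^'n"
  assumes "det M \<noteq> 0"
  shows "M ** matrix_inv M = mat 1"
proof -
  have "\<exists>M'. M ** M' = mat 1 \<and> M' ** M = mat 1"
    using assms by (simp add: invertible_det_nz[symmetric] invertible_def)
  from someI_ex[OF this] show ?thesis by (simp add: matrix_inv_def)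
qed

text \<open>Cramer's rule exhibits the entries of the inverse as quotients of determinants, hence as smooth
  functions of the entries of the matrix.\<close>

lemma matrix_inv_cramer:
  fixes M :: "real^'n^'n"
  assumes "det M \<noteq> 0"
  shows "matrix_inv M $ k $ j = det (\<chi> a b. if b = k then axis j 1 $ a else M $ a $ b) / det M"
proof -
  have "M *v (matrix_inv M *v axis j 1) = axis j 1"
    using matrix_inv_right[OF assms] by (simp add: matrix_vector_mul_assoc)
  then have "matrix_inv M *v axis j 1 = (\<chi> k. det (\<chi> a b. if b = k then axis j 1 $ a else M $ a $ b) / det M)"
    using cramer[OF assms] by blast
  moreover have "(matrix_inv M *v axis j 1) $ k = matrix_inv M $ k $ j"
    by (simp add: matrix_vector_mul_component inner_axis)
  ultimately show ?thesis by simp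
qed

lemma smooth_on_matrix_inv:
  fixes M :: "real^8 \<Rightarrow> real^8^8"
  assumes "open U" "\<And>i j. smooth_on U (\<lambda>u. M u $ i $ j)" "\<And>u. u \<in> U \<Longrightarrow> det (M u) \<noteq> 0"
  shows "smooth_on U (\<lambda>u. matrix_inv (M u) $ i $ j)"
proof (rule smooth_on_cong[OF assms(1)])
  let ?N = "\<lambda>u. \<chi> a b. if b = i then axis j 1 $ a else M u $ a $ b"
  show "smooth_on U (\<lambda>u. det (?N u) / det (M u))"
  proof (intro smooth_on_divide smooth_on_det assms)
    fix a b
    show "smooth_on U (\<lambda>u. ?N u $ a $ b)"
      by (cases "b = i") (simp_all add: smooth_on_const assms(2))
  qed
qed (simp add: matrix_inv_cramer assms(3))


section \<open>Taylor expansion of second order\<close>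

lemma has_derivative_along_line:
  fixes f :: "real^8 \<Rightarrow> real"
  assumes "f differentiable (at (t *\<^sub>R v))"
  shows "((\<lambda>t. f (t *\<^sub>R v)) has_real_derivative (\<Sum>q\<in>UNIV. v $ q * pd q f (t *\<^sub>R v))) (at t)"
proof -
  have line: "((\<lambda>t. t *\<^sub>R v) has_derivative (\<lambda>s. s *\<^sub>R v)) (at t)"
    by (auto intro!: derivative_eq_intros)
  show ?thesis unfolding has_field_derivative_def
    by (rule has_derivative_eq_rhs[OF has_derivative_compose[OF line has_derivative_pd[OF assms]]])
       (simp add: fun_eq_iff sum_distrib_left sum_distrib_right mult_ac)
qed

text \<open>The remainder is the third derivative of $t \mapsto f(tv)$ at some intermediate $t$, which is a
  cubic form in $v$ whose coefficients are bounded on a closed ball.\<close>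

lemma smooth_taylor_2:
  assumes "smooth_on U f" "open U" "0 \<in> U"
  shows "(\<lambda>v. f v - (f 0 + (\<Sum>q\<in>UNIV. pd q f 0 * v $ q)
            + (\<Sum>p\<in>UNIV. \<Sum>q\<in>UNIV. 1/2 * pd p (pd q f) 0 * v $ p * v $ q)))
         \<in> O[nhds 0](\<lambda>v. norm v ^ 3)"
proof -
  obtain r where r: "r > 0" "cball 0 r \<subseteq> U"
    using assms(2,3) open_contains_cball by blast
  have cont: "continuous_on (cball 0 r) (pd p (pd q (pd s f)))" for p q s
    using assms(1) r(2) by (meson continuous_on_subset smooth_on_imp_continuous_on smooth_on_pd)
  have "\<exists>B. \<forall>u\<in>cball 0 r. \<bar>pd p (pd q (pd s f)) u\<bar> \<le> B" for p q s
    using compact_imp_bounded[OF compact_continuous_image[OF cont compact_cball]]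
    by (auto simp: bounded_iff)
  then obtain B where B: "\<And>p q s u. u \<in> cball 0 r \<Longrightarrow> \<bar>pd p (pd q (pd s f)) u\<bar> \<le> B p q s"
    by metis
  define C where "C = (\<Sum>p\<in>UNIV. \<Sum>q\<in>UNIV. \<Sum>s\<in>UNIV. B p q s)"
  show ?thesis
  proof (rule bigoI[where c = C])
    have bound: "\<bar>f v - (f 0 + (\<Sum>q\<in>UNIV. pd q f 0 * v $ q)
            + (\<Sum>p\<in>UNIV. \<Sum>q\<in>UNIV. 1/2 * pd p (pd q f) 0 * v $ p * v $ q))\<bar> \<le> C * norm v ^ 3"
      if v: "v \<in> cball 0 r" for v
    proof -
      have tv: "t *\<^sub>R v \<in> cball 0 r" if "0 \<le> t" "t \<le> 1" for t
        using v that mult_left_le_one_le[of "norm v" t] by simp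
      have along: "((\<lambda>t. h (t *\<^sub>R v)) has_real_derivative (\<Sum>q\<in>UNIV. v $ q * pd q h (t *\<^sub>R v))) (at t)"
        if "smooth_on U h" "0 \<le> t" "t \<le> 1" for h t
        by (rule has_derivative_along_line, rule smooth_on_imp_differentiable[OF that(1) assms(2)])
           (use tv[OF that(2,3)] r(2) in blast)
      \<comment> \<open>the derivatives of order 0, 1, 2 and 3 of $t \mapsto f(tv)$\<close>
      define D where "D m t = (if m = 0 then f (t *\<^sub>R v)
         else if m = 1 then \<Sum>q\<in>UNIV. v $ q * pd q f (t *\<^sub>R v)
         else if m = 2 then \<Sum>q\<in>UNIV. v $ q * (\<Sum>p\<in>UNIV. v $ p * pd p (pd q f) (t *\<^sub>R v))
         else \<Sum>q\<in>UNIV. v $ q * (\<Sum>p\<in>UNIV. v $ p * (\<Sum>s\<in>UNIV. v $ s * pd s (pd p (pd q f)) (t *\<^sub>R v))))"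
        for m :: nat and t
      have "\<exists>t>0. t < 1 \<and> f (1 *\<^sub>R v) = (\<Sum>m<3. D m 0 / fact m * 1 ^ m) + D 3 t / fact 3 * 1 ^ 3"
      proof (rule Maclaurin)
        show "\<forall>m t. m < 3 \<and> 0 \<le> t \<and> t \<le> 1 \<longrightarrow> (D m has_real_derivative D (Suc m) t) (at t)"
        proof (intro allI impI)
          fix m :: nat and t :: real
          assume mt: "m < 3 \<and> 0 \<le> t \<and> t \<le> 1"
          then consider "m = 0" | "m = 1" | "m = 2" by linarith
          then show "(D m has_real_derivative D (Suc m) t) (at t)"
            by cases (use mt in \<open>auto simp: D_def[abs_def] intro!: along DERIV_sum DERIV_cmult smooth_on_pd assms(1)\<close>)
        qed
        show "D 0 = (\<lambda>t. f (t *\<^sub>R v))" by (auto simp: D_def)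
      qed auto
      then obtain t where t: "0 < t" "t < 1" "f v = (\<Sum>m<3. D m 0 / fact m) + D 3 t / fact 3"
        by auto
      have eq: "f v - (f 0 + (\<Sum>q\<in>UNIV. pd q f 0 * v $ q)
            + (\<Sum>p\<in>UNIV. \<Sum>q\<in>UNIV. 1/2 * pd p (pd q f) 0 * v $ p * v $ q)) = D 3 t / 6"
      proof -
        have "D 2 0 / 2 = (\<Sum>q\<in>UNIV. \<Sum>p\<in>UNIV. 1/2 * pd p (pd q f) 0 * v $ p * v $ q)"
          by (simp add: D_def sum_divide_distrib sum_distrib_left mult_ac)
        also have "\<dots> = (\<Sum>p\<in>UNIV. \<Sum>q\<in>UNIV. 1/2 * pd p (pd q f) 0 * v $ p * v $ q)"
          by (rule sum.swap)
        finally show ?thesis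
          using t(3) by (simp add: eval_nat_numeral D_def mult_ac)
      qed
      have "\<bar>D 3 t\<bar> \<le> (\<Sum>q\<in>UNIV. \<Sum>p\<in>UNIV. \<Sum>s\<in>UNIV. \<bar>v $ q\<bar> * (\<bar>v $ p\<bar> * (\<bar>v $ s\<bar> * \<bar>pd s (pd p (pd q f)) (t *\<^sub>R v)\<bar>)))"
        unfolding D_def by (simp add: sum_distrib_left abs_mult[symmetric])
          (intro order.trans[OF sum_abs] sum_mono order.refl)
      also have "\<dots> \<le> (\<Sum>q\<in>UNIV. \<Sum>p\<in>UNIV. \<Sum>s\<in>UNIV. norm v * (norm v * (norm v * B s p q)))"
        using B tv t by (intro sum_mono mult_mono component_le_norm_cart mult_nonneg_nonneg) auto
      also have "\<dots> = norm v ^ 3 * (\<Sum>q\<in>UNIV. \<Sum>p\<in>UNIV. \<Sum>s\<in>UNIV. B s p q)"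
        by (simp add: sum_distrib_left power3_eq_cube mult.assoc)
      also have "(\<Sum>q\<in>UNIV. \<Sum>p\<in>UNIV. \<Sum>s\<in>UNIV. B s p q) = C"
      proof -
        have "(\<Sum>q\<in>UNIV. \<Sum>p\<in>UNIV. \<Sum>s\<in>UNIV. B s p q) = (\<Sum>q\<in>UNIV. \<Sum>s\<in>UNIV. \<Sum>p\<in>UNIV. B s p q)"
          by (intro sum.cong sum.swap refl)
        also have "\<dots> = (\<Sum>s\<in>UNIV. \<Sum>q\<in>UNIV. \<Sum>p\<in>UNIV. B s p q)" by (rule sum.swap)
        also have "\<dots> = C" unfolding C_def by (intro sum.cong sum.swap refl)
        finally show ?thesis .
      qed
      finally have "\<bar>D 3 t / 6\<bar> \<le> C * norm v ^ 3" by (simp add: mult.commute)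
      then show ?thesis using eq by simp
    qed
    have "\<forall>\<^sub>F v in nhds (0 :: real^8). v \<in> ball 0 r"
      using r(1) by (intro eventually_nhds_in_open) auto
    then show "\<forall>\<^sub>F v in nhds 0. norm (f v - (f 0 + (\<Sum>q\<in>UNIV. pd q f 0 * v $ q)
            + (\<Sum>p\<in>UNIV. \<Sum>q\<in>UNIV. 1/2 * pd p (pd q f) 0 * v $ p * v $ q))) \<le> C * norm (norm v ^ 3)"
      by (rule eventually_mono) (use bound in \<open>simp add: less_imp_le\<close>)
  qed
qed


section \<open>Tangent spaces and the metric in a chart\<close>

locale smooth_manifold =
  fixes A :: "'m::{t2_space, second_countable_topology} chart set"
  assumes atlas: "smooth_structure A"
begin

lemma chart:
  assumes "c \<in> A"
  shows open_fst: "open (fst c)" and open_img: "open (img c)"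
    and chart_homeomorphism: "homeomorphism (fst c) (img c) (snd c) (inv_chart c)"
  using atlas assms by (auto simp: smooth_structure_def is_chart_def)

lemma inv_chart_in: "c \<in> A \<Longrightarrow> v \<in> img c \<Longrightarrow> inv_chart c v \<in> fst c"
  using chart_homeomorphism homeomorphism_image2 by blast

lemma chart_inv_chart: "c \<in> A \<Longrightarrow> v \<in> img c \<Longrightarrow> snd c (inv_chart c v) = v"
  using chart_homeomorphism homeomorphism_apply2 by blast

lemma inv_chart_chart: "c \<in> A \<Longrightarrow> p \<in> fst c \<Longrightarrow> inv_chart c (snd c p) = p"
  using chart_homeomorphism homeomorphism_apply1 by blast

lemma chart_in_img: "p \<in> fst c \<Longrightarrow> snd c p \<in> img c"
  by (simp add: img_def)

lemma open_overlap:
  assumes "c \<in> A" "c' \<in> A"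
  shows "open (snd c ` (fst c \<inter> fst c'))"
proof -
  have "snd c ` (fst c \<inter> fst c') = img c \<inter> inv_chart c -` fst c'"
    using inv_chart_chart[OF assms(1)] chart_inv_chart[OF assms(1)] inv_chart_in[OF assms(1)]
    by (force simp: img_def)
  then show ?thesis
    using continuous_open_preimage[OF _ open_img[OF assms(1)] open_fst[OF assms(2)]]
      homeomorphism_cont2[OF chart_homeomorphism[OF assms(1)]] by simp
qed

lemma transition_differentiable:
  assumes "c \<in> A" "c' \<in> A" "p \<in> fst c" "p \<in> fst c'"
  shows "transition c c' differentiable (at (snd c p))"
proof -
  have "(\<lambda>v. transition c c' v $ i) differentiable (at (snd c p))" for i
  proof (rule smooth_on_imp_differentiable)
    show "smooth_on (snd c ` (fst c \<inter> fst c')) (\<lambda>v. transition c c' v $ i)"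
      using atlas assms(1,2) by (auto simp: smooth_structure_def compatible_def)
    show "snd c p \<in> snd c ` (fst c \<inter> fst c')" using assms by blast
  qed (rule open_overlap[OF assms(1,2)])
  then show ?thesis
    by (subst differentiable_componentwise_within) (auto simp: Basis_vec_def cart_eq_inner_axis)
qed

lemma transition_chart:
  "c \<in> A \<Longrightarrow> p \<in> fst c \<Longrightarrow> transition c c' (snd c p) = snd c' p"
  by (simp add: transition_def inv_chart_chart)

lemma linear_transition_derivative:
  assumes "c \<in> A" "c' \<in> A" "p \<in> fst c" "p \<in> fst c'"
  shows "linear (frechet_derivative (transition c c') (at (snd c p)))"
  using transition_differentiable[OF assms] by (rule linear_frechet_derivative)

lemma tangent_space_linear_combination:
  assumes "u \<in> tangent_space A p" "w \<in> tangent_space A p"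
  shows "(\<lambda>c. a *\<^sub>R u c + b *\<^sub>R w c) \<in> tangent_space A p"
  unfolding tangent_space_def mem_Collect_eq
proof (intro conjI ballI allI impI; (elim conjE)?)
  fix c c' assume c: "c \<in> A" "c' \<in> A" "p \<in> fst c" "p \<in> fst c'"
  let ?D = "frechet_derivative (transition c c') (at (snd c p))"
  have "u c' = ?D (u c)" "w c' = ?D (w c)"
    using assms c unfolding tangent_space_def by blast+
  then show "a *\<^sub>R u c' + b *\<^sub>R w c' = ?D (a *\<^sub>R u c + b *\<^sub>R w c)"
    using linear_transition_derivative[OF c] by (simp add: linear_add linear_cmul)
next
  fix c assume "\<not> (c \<in> A \<and> p \<in> fst c)"
  then show "a *\<^sub>R u c + b *\<^sub>R w c = 0"
    using assms unfolding tangent_space_def mem_Collect_eq by (metis add_0 scaleR_zero_right)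
qed

lemma zero_in_tangent_space: "(\<lambda>c. 0) \<in> tangent_space A p"
  unfolding tangent_space_def mem_Collect_eq using linear_transition_derivative linear_0
  by (metis (no_types, lifting))

text \<open>The coefficient 1 is spelled out so that the right-hand side has the shape in which
  multilinearity of tensors is formulated.\<close>

lemma lincomb_step:
  fixes e :: "'i \<Rightarrow> 'm tvec"
  assumes "finite I" "i \<notin> I"
  shows "(\<lambda>c. \<Sum>j\<in>insert i I. a j *\<^sub>R e j c) = (\<lambda>c. a i *\<^sub>R e i c + 1 *\<^sub>R (\<Sum>j\<in>I. a j *\<^sub>R e j c))"
  using assms by simp

lemma tangent_space_sum:
  assumes "finite I" "\<And>i. e i \<in> tangent_space A p"
  shows "(\<lambda>c. \<Sum>i\<in>I. a i *\<^sub>R e i c) \<in> tangent_space A p"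
  using assms(1)
proof induction
  case (insert i I)
  show ?case unfolding lincomb_step[OF insert.hyps]
    by (rule tangent_space_linear_combination[OF assms(2) insert.IH])
qed (simp add: zero_in_tangent_space)

lemma lincomb_in_tangent_space:
  "(\<And>i. e i \<in> tangent_space A p) \<Longrightarrow> lincomb e a \<in> tangent_space A p"
  unfolding lincomb_def by (rule tangent_space_sum) auto

lemma coord_vec_self:
  assumes "c \<in> A" "p \<in> fst c"
  shows "coord_vec A c p i c = axis i 1"
proof -
  have "(transition c c has_derivative (\<lambda>h. h)) (at (snd c p))"
  proof (rule has_derivative_transform_within_open[OF has_derivative_ident open_img[OF assms(1)] chart_in_img[OF assms(2)]])
    show "v = transition c c v" if "v \<in> img c" for v
      using chart_inv_chart[OF assms(1) that] by (simp add: transition_def)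
  qed
  from frechet_derivative_at[OF this] show ?thesis
    using assms by (simp add: coord_vec_def fun_eq_iff)
qed

text \<open>The compatibility of the components is the chain rule for a composition of transition maps.\<close>

lemma coord_vec_in_tangent_space:
  assumes c: "c \<in> A" "p \<in> fst c"
  shows "coord_vec A c p i \<in> tangent_space A p"
proof -
  have chain: "frechet_derivative (transition c c'') (at (snd c p)) h =
        frechet_derivative (transition c' c'') (at (snd c' p))
          (frechet_derivative (transition c c') (at (snd c p)) h)"
    if c': "c' \<in> A" "p \<in> fst c'" and c'': "c'' \<in> A" "p \<in> fst c''" for c' c'' h
  proof -
    let ?D = "frechet_derivative (transition c c') (at (snd c p))"
    let ?D' = "frechet_derivative (transition c' c'') (at (snd c' p))"
    have "(transition c c' has_derivative ?D) (at (snd c p))"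
      using transition_differentiable[OF c(1) c'(1) c(2) c'(2)] frechet_derivative_works by blast
    moreover have "(transition c' c'' has_derivative ?D') (at (transition c c' (snd c p)))"
      using transition_differentiable[OF c'(1) c''(1) c'(2) c''(2)]
      by (simp add: transition_chart[OF c] frechet_derivative_works[symmetric])
    ultimately have "(transition c' c'' \<circ> transition c c' has_derivative ?D' \<circ> ?D) (at (snd c p))"
      by (rule diff_chain_at)
    then have "(transition c c'' has_derivative ?D' \<circ> ?D) (at (snd c p))"
    proof (rule has_derivative_transform_within_open[OF _ open_overlap[OF c(1) c'(1)]])
      show "snd c p \<in> snd c ` (fst c \<inter> fst c')" using c(2) c'(2) by blast
      show "(transition c' c'' \<circ> transition c c') v = transition c c'' v"
        if "v \<in> snd c ` (fst c \<inter> fst c')" for v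
        using that inv_chart_chart[OF c(1)] inv_chart_chart[OF c'(1)] by (auto simp: transition_def)
    qed
    from frechet_derivative_at[OF this] show ?thesis by (simp add: fun_eq_iff)
  qed
  show ?thesis
    unfolding tangent_space_def mem_Collect_eq
  proof (intro conjI ballI allI impI)
    fix c' c'' assume "c' \<in> A" "c'' \<in> A" "p \<in> fst c' \<and> p \<in> fst c''"
    then show "coord_vec A c p i c'' =
        frechet_derivative (transition c' c'') (at (snd c' p)) (coord_vec A c p i c')"
      using chain[of c' c'' "axis i 1"] by (simp add: coord_vec_def)
  qed (auto simp: coord_vec_def)
qed

end

locale riemannian_chart = smooth_manifold A
  for A :: "'m::{t2_space, second_countable_topology} chart set" +
  fixes g :: "'m tensor" and c :: "'m chart"
  assumes metric: "riemannian_metric A g" and c_in_atlas: "c \<in> A"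
begin

abbreviation gram :: "8 \<Rightarrow> 8 \<Rightarrow> real^8 \<Rightarrow> real" where
  "gram i j \<equiv> tcomp A g c [i, j]"

abbreviation \<Gamma> :: "8 \<Rightarrow> 8 \<Rightarrow> 8 \<Rightarrow> real^8 \<Rightarrow> real" where
  "\<Gamma> \<equiv> christoffel A g c"

lemmas open_chart_img = open_img[OF c_in_atlas]

lemma metric_commute:
  "u \<in> tangent_space A p \<Longrightarrow> w \<in> tangent_space A p \<Longrightarrow> g p [u, w] = g p [w, u]"
  using metric by (auto simp: riemannian_metric_def)

lemma metric_linear_left:
  assumes "u \<in> tangent_space A p" "u' \<in> tangent_space A p" "w \<in> tangent_space A p"
  shows "g p [\<lambda>c. a *\<^sub>R u c + b *\<^sub>R u' c, w] = a * g p [u, w] + b * g p [u', w]"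
proof -
  have "multilinear A 2 g" using metric by (simp add: riemannian_metric_def tensor_field_def)
  from this[unfolded multilinear_def, rule_format, of "[w, w]" p 0 u u' a b] assms
  show ?thesis by simp
qed

lemma metric_sum_left:
  assumes "finite I" "\<And>i. e i \<in> tangent_space A p" "w \<in> tangent_space A p"
  shows "g p [\<lambda>c. \<Sum>i\<in>I. a i *\<^sub>R e i c, w] = (\<Sum>i\<in>I. a i * g p [e i, w])"
  using assms(1)
proof induction
  case empty
  show ?case using metric_linear_left[OF assms(3,3,3), of 0 0] by simp
next
  case (insert i I)
  show ?case unfolding lincomb_step[OF insert.hyps]
    using metric_linear_left[OF assms(2) tangent_space_sum[OF insert.hyps(1) assms(2)] assms(3), of "a i" i 1 a] insert
    by simp
qed

lemma gram_commute:
  assumes "v \<in> img c" shows "gram i j v = gram j i v"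
  using metric_commute[OF coord_vec_in_tangent_space coord_vec_in_tangent_space]
    c_in_atlas inv_chart_in[OF c_in_atlas assms] by (simp add: tcomp_def)

text \<open>A vector in the kernel of the matrix gives a tangent vector that is orthogonal to itself, which a
  positive definite metric excludes.\<close>

lemma det_gram_nonzero:
  assumes v: "v \<in> img c"
  shows "det (\<chi> i j. gram i j v) \<noteq> 0"
proof -
  let ?G = "\<chi> i j. gram i j v" and ?p = "inv_chart c v"
  let ?e = "coord_vec A c ?p"
  have p: "?p \<in> fst c" by (rule inv_chart_in[OF c_in_atlas v])
  have e: "?e i \<in> tangent_space A ?p" for i
    by (rule coord_vec_in_tangent_space[OF c_in_atlas p])
  have "w = 0" if "?G *v w = 0" for w
  proof (rule ccontr)
    assume "w \<noteq> 0"
    let ?u = "lincomb ?e w"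
    have u: "?u \<in> tangent_space A ?p" by (rule lincomb_in_tangent_space[OF e])
    have "?u c = w"
      using basis_expansion[of w]
      by (simp add: lincomb_def coord_vec_self[OF c_in_atlas p] scalar_mult_eq_scaleR)
    with \<open>w \<noteq> 0\<close> have "?u \<noteq> (\<lambda>c. 0)" by metis
    then have "g ?p [?u, ?u] > 0"
      using metric u by (auto simp: riemannian_metric_def)
    moreover have "g ?p [?e i, ?u] = 0" for i
    proof -
      have "g ?p [?e i, ?u] = (\<Sum>j\<in>UNIV. w $ j * g ?p [?e j, ?e i])"
        unfolding metric_commute[OF e u] unfolding lincomb_def
        by (rule metric_sum_left) (auto simp: e)
      also have "\<dots> = (?G *v w) $ i"
        using metric_commute[OF e e] by (simp add: matrix_vector_mult_def tcomp_def mult.commute)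
      finally show ?thesis using that by simp
    qed
    moreover have "g ?p [?u, ?u] = (\<Sum>i\<in>UNIV. w $ i * g ?p [?e i, ?u])"
      by (subst (1) lincomb_def) (rule metric_sum_left, auto simp: e u)
    ultimately show False by simp
  qed
  then have "inj ((*v) ?G)"
    using linear_injective_0[OF matrix_vector_mul_linear] by blast
  then show ?thesis
    using det_nz_iff_inj[of "(*v) ?G"] by simp
qed

lemma smooth_gram: "smooth_on (img c) (gram i j)"
  using metric c_in_atlas by (simp add: riemannian_metric_def tensor_field_def)

lemma smooth_ginv: "smooth_on (img c) (ginv A g c i j)"
  unfolding ginv_def[abs_def]
  by (rule smooth_on_matrix_inv) (simp_all add: open_chart_img smooth_gram det_gram_nonzero)

lemma ginv_gram:
  assumes "v \<in> img c"
  shows "(\<Sum>b\<in>UNIV. gram a b v * ginv A g c b d v) = (if a = d then 1 else 0)"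
proof -
  let ?G = "\<chi> i j. gram i j v"
  have "(?G ** matrix_inv ?G) $ a $ d = (if a = d then 1 else 0)"
    using matrix_inv_right[OF det_gram_nonzero[OF assms]] by (simp add: mat_def)
  then show ?thesis by (simp add: matrix_matrix_mult_def ginv_def)
qed

lemma smooth_christoffel: "smooth_on (img c) (\<Gamma> k i j)"
  unfolding christoffel_def[abs_def]
  by (intro smooth_on_mult smooth_on_const smooth_on_sum smooth_on_add smooth_on_diff smooth_on_pd
        smooth_ginv smooth_gram open_chart_img) auto

lemma christoffel_commute:
  assumes v: "v \<in> img c" shows "\<Gamma> k i j v = \<Gamma> k j i v"
proof -
  have "pd l (gram i j) v = pd l (gram j i) v" for l
    using open_chart_img v gram_commute by (rule pd_cong_open)
  then show ?thesis by (simp add: christoffel_def add.commute)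
qed

end


section \<open>Local uniqueness for ordinary differential equations\<close>

definition lipschitz_near :: "('a::metric_space \<Rightarrow> 'b::metric_space) \<Rightarrow> 'a \<Rightarrow> bool" where
  "lipschitz_near f z \<longleftrightarrow> (\<exists>r>0. \<exists>L. L-lipschitz_on (cball z r) f)"

lemma lipschitz_near_const: "lipschitz_near (\<lambda>_. a) z"
  unfolding lipschitz_near_def using lipschitz_on_constant zero_less_one by blast

lemma lipschitz_near_compose:
  assumes "L-lipschitz_on UNIV h" "lipschitz_near f (h z)"
  shows "lipschitz_near (\<lambda>u. f (h u)) z"
proof -
  obtain r M where r: "r > 0" "M-lipschitz_on (cball (h z) r) f"
    using assms(2) by (auto simp: lipschitz_near_def)
  have L: "L \<ge> 0" using assms(1) lipschitz_on_nonneg by blast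
  have "h ` cball z (r / (L + 1)) \<subseteq> cball (h z) r"
  proof (clarsimp)
    fix u assume u: "dist z u \<le> r / (L + 1)"
    have "dist (h z) (h u) \<le> L * dist z u"
      using assms(1) by (auto simp: lipschitz_on_def)
    also have "\<dots> \<le> (L + 1) * (r / (L + 1))"
      using u L r(1) by (intro mult_mono) auto
    also have "\<dots> = r" using L by simp
    finally show "dist (h z) (h u) \<le> r" .
  qed
  then have "(M * L)-lipschitz_on (cball z (r / (L + 1))) (\<lambda>u. f (h u))"
    using lipschitz_on_compose2[OF lipschitz_on_subset[OF assms(1) subset_UNIV] lipschitz_on_subset[OF r(2)]]
    by blast
  moreover have "r / (L + 1) > 0" using r(1) L by simp
  ultimately show ?thesis unfolding lipschitz_near_def by blast
qed

lemma lipschitz_near_id: "lipschitz_near (\<lambda>u. u) z"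
  unfolding lipschitz_near_def using lipschitz_on_id zero_less_one by blast

lemma lipschitz_near_add:
  fixes f f' :: "'a::metric_space \<Rightarrow> real"
  assumes "lipschitz_near f z" "lipschitz_near f' z"
  shows "lipschitz_near (\<lambda>u. f u + f' u) z"
proof -
  obtain r L r' L' where r: "r > 0" "L-lipschitz_on (cball z r) f"
    and r': "r' > 0" "L'-lipschitz_on (cball z r') f'"
    using assms by (auto simp: lipschitz_near_def)
  have "(L + L')-lipschitz_on (cball z (min r r')) (\<lambda>u. f u + f' u)"
    by (intro lipschitz_on_add lipschitz_on_subset[OF r(2)] lipschitz_on_subset[OF r'(2)]) auto
  then show ?thesis unfolding lipschitz_near_def using r(1) r'(1) by (metis min_less_iff_conj)
qed

lemma lipschitz_near_mult:
  fixes f f' :: "'a::metric_space \<Rightarrow> real"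
  assumes "lipschitz_near f z" "lipschitz_near f' z"
  shows "lipschitz_near (\<lambda>u. f u * f' u) z"
proof -
  obtain r L r' L' where r: "r > 0" "L-lipschitz_on (cball z r) f"
    and r': "r' > 0" "L'-lipschitz_on (cball z r') f'"
    using assms by (auto simp: lipschitz_near_def)
  define s where "s = min r r'"
  have s: "s > 0" "L-lipschitz_on (cball z s) f" "L'-lipschitz_on (cball z s) f'"
    using r r' by (auto simp: s_def intro: lipschitz_on_subset)
  have L: "L \<ge> 0" "L' \<ge> 0" using s(2,3) lipschitz_on_nonneg by blast+
  have bound: "\<bar>h u\<bar> \<le> \<bar>h z\<bar> + M * s" if "M-lipschitz_on (cball z s) h" "u \<in> cball z s"
    for h :: "'a \<Rightarrow> real" and M u
  proof -
    have "\<bar>h z - h u\<bar> \<le> M * dist z u"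
      using lipschitz_onD[OF that(1), of z u] that(2) s(1) by (simp add: dist_real_def)
    also have "\<dots> \<le> M * s"
      using that lipschitz_on_nonneg[OF that(1)] by (intro mult_left_mono) auto
    finally show ?thesis by linarith
  qed
  let ?B = "\<bar>f z\<bar> + L * s" and ?B' = "\<bar>f' z\<bar> + L' * s"
  have "(?B * L' + ?B' * L)-lipschitz_on (cball z s) (\<lambda>u. f u * f' u)"
  proof (rule lipschitz_onI)
    fix u w assume uw: "u \<in> cball z s" "w \<in> cball z s"
    have "f u * f' u - f w * f' w = f u * (f' u - f' w) + f' w * (f u - f w)"
      by (simp add: algebra_simps)
    then have "dist (f u * f' u) (f w * f' w) \<le> \<bar>f u\<bar> * dist (f' u) (f' w) + \<bar>f' w\<bar> * dist (f u) (f w)"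
      by (simp add: dist_real_def abs_mult[symmetric])
    also have "\<dots> \<le> ?B * (L' * dist u w) + ?B' * (L * dist u w)"
      using bound[OF s(2) uw(1)] bound[OF s(3) uw(2)] lipschitz_onD[OF s(2) uw] lipschitz_onD[OF s(3) uw] L
      by (intro add_mono mult_mono) auto
    also have "\<dots> = (?B * L' + ?B' * L) * dist u w" by (simp add: algebra_simps)
    finally show "dist (f u * f' u) (f w * f' w) \<le> (?B * L' + ?B' * L) * dist u w" .
  qed (use L s(1) in auto)
  then show ?thesis unfolding lipschitz_near_def using s(1) by blast
qed

lemma lipschitz_near_sum:
  fixes f :: "'i \<Rightarrow> 'a::metric_space \<Rightarrow> real"
  assumes "finite I" "\<And>i. i \<in> I \<Longrightarrow> lipschitz_near (f i) z"
  shows "lipschitz_near (\<lambda>u. \<Sum>i\<in>I. f i u) z"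
  using assms by (induction I rule: finite_induct) (auto intro: lipschitz_near_add lipschitz_near_const)

lemma lipschitz_near_vec:
  fixes f :: "'a::metric_space \<Rightarrow> real^'n"
  assumes "\<And>i. lipschitz_near (\<lambda>u. f u $ i) z"
  shows "lipschitz_near f z"
proof -
  obtain r L where rL: "\<And>i. r i > 0" "\<And>i. (L i)-lipschitz_on (cball z (r i)) (\<lambda>u. f u $ i)"
    using assms unfolding lipschitz_near_def by metis
  let ?s = "Min (range r)"
  have s: "?s > 0" "\<And>i. ?s \<le> r i" using rL(1) by auto
  have "(\<Sum>i\<in>UNIV. L i)-lipschitz_on (cball z ?s) f"
  proof (rule lipschitz_onI)
    fix u w assume uw: "u \<in> cball z ?s" "w \<in> cball z ?s"
    have "dist (f u $ i) (f w $ i) \<le> L i * dist u w" for i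
      using uw s(2)[of i] by (intro lipschitz_onD[OF rL(2)]) auto
    then have "dist (f u) (f w) \<le> (\<Sum>i\<in>UNIV. L i * dist u w)"
      unfolding dist_norm by (intro order.trans[OF norm_le_l1_cart] sum_mono) simp
    then show "dist (f u) (f w) \<le> (\<Sum>i\<in>UNIV. L i) * dist u w" by (simp add: sum_distrib_right)
  qed (use rL(2) lipschitz_on_nonneg in \<open>auto intro!: sum_nonneg\<close>)
  then show ?thesis unfolding lipschitz_near_def using s(1) by blast
qed

lemma lipschitz_near_Pair:
  assumes "lipschitz_near f z" "lipschitz_near f' z"
  shows "lipschitz_near (\<lambda>u. (f u, f' u)) z"
proof -
  obtain r L r' L' where r: "r > 0" "L-lipschitz_on (cball z r) f"
    and r': "r' > 0" "L'-lipschitz_on (cball z r') f'"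
    using assms by (auto simp: lipschitz_near_def)
  have "(sqrt (L^2 + L'^2))-lipschitz_on (cball z (min r r')) (\<lambda>u. (f u, f' u))"
    by (intro lipschitz_on_Pair lipschitz_on_subset[OF r(2)] lipschitz_on_subset[OF r'(2)]) auto
  then show ?thesis unfolding lipschitz_near_def using r(1) r'(1) by (metis min_less_iff_conj)
qed

lemma smooth_on_imp_lipschitz_near:
  assumes "smooth_on U f" "open U" "y \<in> U"
  shows "lipschitz_near f y"
proof -
  obtain r where r: "r > 0" "cball y r \<subseteq> U"
    using assms(2,3) open_contains_cball by blast
  have "\<exists>B. \<forall>u\<in>cball y r. \<bar>pd i f u\<bar> \<le> B" for i
  proof -
    have "continuous_on (cball y r) (pd i f)"
      using smooth_on_imp_continuous_on[OF smooth_on_pd[OF assms(1)]] r(2) continuous_on_subset by blast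
    from compact_imp_bounded[OF compact_continuous_image[OF this compact_cball]]
    show ?thesis by (auto simp: bounded_iff)
  qed
  then obtain B where B: "\<And>i u. u \<in> cball y r \<Longrightarrow> \<bar>pd i f u\<bar> \<le> B i" by metis
  have B0: "B i \<ge> 0" for i using B[of y i] r(1) by fastforce
  have "(\<Sum>i\<in>UNIV. B i)-lipschitz_on (cball y r) f"
  proof (rule lipschitz_onI)
    fix u w assume "u \<in> cball y r" "w \<in> cball y r"
    then show "dist (f u) (f w) \<le> (\<Sum>i\<in>UNIV. B i) * dist u w"
      unfolding dist_norm
    proof (rule differentiable_bound[OF convex_cball, rotated 2])
      fix u assume u: "u \<in> cball y r"
      then have "f differentiable (at u)"
        using smooth_on_imp_differentiable[OF assms(1,2)] r(2) by blast
      from has_derivative_pd[OF this]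
      show "(f has_derivative (\<lambda>h. \<Sum>i\<in>UNIV. h $ i * pd i f u)) (at u within cball y r)"
        by (rule has_derivative_at_withinI)
      show "onorm (\<lambda>h. \<Sum>i\<in>UNIV. h $ i * pd i f u) \<le> (\<Sum>i\<in>UNIV. B i)"
      proof (rule onorm_bound)
        fix h :: "real^8"
        have "norm (\<Sum>i\<in>UNIV. h $ i * pd i f u) \<le> (\<Sum>i\<in>UNIV. norm h * B i)"
          using B[OF u]
          by (intro sum_norm_le) (auto simp: abs_mult component_le_norm_cart intro!: mult_mono)
        then show "norm (\<Sum>i\<in>UNIV. h $ i * pd i f u) \<le> (\<Sum>i\<in>UNIV. B i) * norm h"
          by (simp add: sum_distrib_left mult.commute)
      qed (simp add: B0 sum_nonneg)
    qed
  qed (simp add: B0 sum_nonneg)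
  then show ?thesis unfolding lipschitz_near_def using r(1) by blast
qed

text \<open>On a short interval of radius $d$ with $Ld \leq \frac12$ the mean value inequality bounds the
  maximum of $|z_1 - z_2|$ by half of itself. The argument works on both sides of $t_0$ at once.\<close>

lemma ode_unique_near:
  fixes z1 z2 :: "real \<Rightarrow> 'a::real_normed_vector"
  assumes S: "compact S" "convex S" "t0 \<in> S" and D: "open D" "t0 \<in> D"
    and z1: "\<And>t. t \<in> S \<inter> D \<Longrightarrow> (z1 has_vector_derivative X (z1 t)) (at t within S)"
    and z2: "\<And>t. t \<in> S \<inter> D \<Longrightarrow> (z2 has_vector_derivative X (z2 t)) (at t within S)"
    and eq: "z1 t0 = z2 t0" and X: "lipschitz_near X (z1 t0)"
  shows "\<exists>d>0. \<forall>t\<in>S. dist t t0 < d \<longrightarrow> z1 t = z2 t"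
proof -
  obtain r L where r: "r > 0" "L-lipschitz_on (cball (z1 t0) r) X"
    using X by (auto simp: lipschitz_near_def)
  have L: "L \<ge> 0" using r(2) lipschitz_on_nonneg by blast
  have near: "\<exists>d>0. \<forall>t\<in>S. dist t t0 < d \<longrightarrow> z t \<in> cball (z t0) r"
    if "(z has_vector_derivative a) (at t0 within S)" for z a
    using has_vector_derivative_continuous[OF that] r(1)
    by (fastforce simp: continuous_within_eps_delta dist_commute)
  obtain d1 where d1: "d1 > 0" "\<And>t. t \<in> S \<Longrightarrow> dist t t0 < d1 \<Longrightarrow> z1 t \<in> cball (z1 t0) r"
    using near[OF z1] S(3) D(2) by blast
  obtain d2 where d2: "d2 > 0" "\<And>t. t \<in> S \<Longrightarrow> dist t t0 < d2 \<Longrightarrow> z2 t \<in> cball (z1 t0) r"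
    using near[OF z2] S(3) D(2) eq by auto
  obtain d3 where d3: "d3 > 0" "ball t0 d3 \<subseteq> D"
    using D openE by blast
  define d where "d = min (min d1 d2) (min d3 (1 / (L + 1))) / 2"
  have d: "d > 0" "d < d1" "d < d2" "d < d3" "L * d \<le> 1/2"
  proof -
    show d0: "d > 0" "d < d1" "d < d2" "d < d3"
      using d1(1) d2(1) d3(1) L by (auto simp: d_def)
    have "d \<le> 1 / (L + 1) / 2" unfolding d_def by (intro divide_right_mono) auto
    then have "L * d \<le> L * (1 / (L + 1) / 2)" using L by (intro mult_left_mono) auto
    also have "\<dots> \<le> 1/2" using L by (simp add: field_simps)
    finally show "L * d \<le> 1/2" .
  qed
  define J where "J = S \<inter> cball t0 d"
  have J: "compact J" "convex J" "t0 \<in> J"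
    using S d(1) by (auto simp: J_def convex_Int)
  have JS: "J \<subseteq> S \<inter> D" using d d3(2) by (auto simp: J_def subset_iff)
  have inball: "z1 t \<in> cball (z1 t0) r" "z2 t \<in> cball (z1 t0) r" if "t \<in> J" for t
    using that d d1(2)[of t] d2(2)[of t] by (auto simp: J_def dist_commute)
  let ?f = "\<lambda>t. z1 t - z2 t"
  have der: "(?f has_vector_derivative X (z1 t) - X (z2 t)) (at t within J)" if "t \<in> J" for t
    using that z1[of t] z2[of t] JS
    by (intro has_vector_derivative_diff; blast intro: has_vector_derivative_within_subset)
  then have "continuous_on J ?f"
    by (meson continuous_on_eq_continuous_within has_vector_derivative_continuous)
  then have "continuous_on J (\<lambda>t. norm (?f t))" by (rule continuous_on_norm)
  from continuous_attains_sup[OF J(1) _ this] J(3)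
  obtain s where s: "s \<in> J" "\<And>t. t \<in> J \<Longrightarrow> norm (?f t) \<le> norm (?f s)" by blast
  let ?M = "norm (?f s)"
  have "norm (?f s - ?f t0) \<le> (L * ?M) * norm (s - t0)"
  proof (rule differentiable_bound[OF J(2) _ _ s(1) J(3)])
    fix t assume t: "t \<in> J"
    show "(?f has_derivative (\<lambda>h. h *\<^sub>R (X (z1 t) - X (z2 t)))) (at t within J)"
      using der[OF t] by (simp add: has_vector_derivative_def)
    have "norm (X (z1 t) - X (z2 t)) \<le> L * norm (?f t)"
      using lipschitz_on_normD[OF r(2) inball[OF t]] .
    also have "\<dots> \<le> L * ?M" using s(2)[OF t] L by (rule mult_left_mono)
    finally show "onorm (\<lambda>h. h *\<^sub>R (X (z1 t) - X (z2 t))) \<le> L * ?M"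
      by (intro onorm_bound) (auto simp: L mult.commute mult_left_mono)
  qed
  also have "\<dots> \<le> (L * ?M) * d"
    using s(1) L by (intro mult_left_mono) (auto simp: J_def dist_norm norm_minus_commute)
  also have "\<dots> \<le> 1/2 * ?M"
    using mult_right_mono[OF d(5), of ?M] by (simp add: mult_ac)
  finally have "?M \<le> 0" using eq by simp
  then have "z1 t = z2 t" if "t \<in> J" for t using s(2)[OF that] by simp
  then show ?thesis using d(1) by (intro exI[of _ d]) (auto simp: J_def dist_commute)
qed


section \<open>Geodesics in normal coordinates\<close>

context riemannian_chart
begin

definition acceleration :: "real^8 \<Rightarrow> real^8 \<Rightarrow> real^8" where
  "acceleration y w = (\<chi> k. - (\<Sum>i\<in>UNIV. \<Sum>j\<in>UNIV. \<Gamma> k i j y * w $ i * w $ j))"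

text \<open>The geodesic equation as a first order system for position and velocity.\<close>

definition geodesic_field :: "(real^8) \<times> (real^8) \<Rightarrow> (real^8) \<times> (real^8)" where
  "geodesic_field z = (snd z, acceleration (fst z) (snd z))"

lemma lipschitz_near_geodesic_field:
  assumes "fst z \<in> img c"
  shows "lipschitz_near geodesic_field z"
proof -
  have fst: "1-lipschitz_on UNIV (fst :: (real^8) \<times> (real^8) \<Rightarrow> _)"
    and snd: "1-lipschitz_on UNIV (snd :: (real^8) \<times> (real^8) \<Rightarrow> _)"
    and nth: "1-lipschitz_on UNIV (\<lambda>w :: real^8. w $ i)" for i
    by (simp_all add: lipschitz_on_def dist_fst_le dist_snd_le dist_vec_nth_le)
  have \<Gamma>: "lipschitz_near (\<lambda>z. \<Gamma> k i j (fst z)) z" for k i j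
    by (rule lipschitz_near_compose[OF fst])
       (rule smooth_on_imp_lipschitz_near[OF smooth_christoffel open_chart_img assms])
  have snd': "lipschitz_near snd z"
    by (rule lipschitz_near_compose[OF snd lipschitz_near_id])
  have w: "lipschitz_near (\<lambda>z. snd z $ i) z" for i :: 8
    using lipschitz_near_compose[OF nth lipschitz_near_id]
    by (rule lipschitz_near_compose[OF snd])
  have "lipschitz_near (\<lambda>z. - 1 * (\<Sum>i\<in>UNIV. \<Sum>j\<in>UNIV. \<Gamma> k i j (fst z) * snd z $ i * snd z $ j)) z" for k
    by (intro lipschitz_near_mult lipschitz_near_const lipschitz_near_sum \<Gamma> w) auto
  then have "lipschitz_near (\<lambda>z. acceleration (fst z) (snd z)) z"
    by (intro lipschitz_near_vec) (simp add: acceleration_def)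
  then show ?thesis
    unfolding geodesic_field_def[abs_def] by (rule lipschitz_near_Pair[OF snd'])
qed

lemma geodesic_chart_derivatives:
  assumes "geodesic A g \<gamma> \<gamma>'" "t \<in> {0..1}" "\<gamma> t \<in> fst c"
  shows "((\<lambda>s. snd c (\<gamma> s)) has_vector_derivative \<gamma>' t c) (at t within {0..1})"
    and "((\<lambda>s. \<gamma>' s c) has_vector_derivative acceleration (snd c (\<gamma> t)) (\<gamma>' t c)) (at t within {0..1})"
  using assms c_in_atlas by (auto simp: geodesic_def acceleration_def)

text \<open>The times at which position and velocity agree with the solution in the chart form a closed and
  open subset of the unit interval. Closedness needs the Hausdorff property, since the geodesic
  is not known in advance to stay in the chart; openness is local uniqueness for the geodesic
  equation.\<close>

lemma geodesic_determined_in_chart: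
  assumes geo: "geodesic A g \<gamma> \<gamma>'"
    and y: "\<And>t. t \<in> {0..1} \<Longrightarrow> y t \<in> img c"
      "\<And>t. t \<in> {0..1} \<Longrightarrow> (y has_vector_derivative w t) (at t within {0..1})"
      "\<And>t. t \<in> {0..1} \<Longrightarrow> (w has_vector_derivative acceleration (y t) (w t)) (at t within {0..1})"
    and init: "\<gamma> 0 = inv_chart c (y 0)" "\<gamma>' 0 c = w 0"
    and t: "t \<in> {0..1}"
  shows "\<gamma> t = inv_chart c (y t)"
proof -
  define C where "C = {t\<in>{0..1}. \<gamma> t = inv_chart c (y t)}"
  define E where "E = {t\<in>C. \<gamma>' t c - w t = 0}"
  have \<gamma>: "continuous_on {0..1} \<gamma>" using geo by (simp add: geodesic_def)
  have C_sub: "C \<subseteq> {0..1}" by (auto simp: C_def)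
  have C_fst: "\<gamma> t \<in> fst c" if "t \<in> C" for t
    using that inv_chart_in[OF c_in_atlas y(1)] by (auto simp: C_def)
  have cont_y: "continuous_on {0..1} y" and cont_w: "continuous_on {0..1} w"
    unfolding continuous_on_eq_continuous_within
    by (blast intro: has_vector_derivative_continuous[OF y(2)] has_vector_derivative_continuous[OF y(3)])+
  have "continuous_on {0..1} (\<lambda>t. inv_chart c (y t))"
    by (rule continuous_on_compose2[OF homeomorphism_cont2[OF chart_homeomorphism[OF c_in_atlas]] cont_y])
       (use y(1) in auto)
  then have "closed ({0..1} \<inter> (\<lambda>t. (\<gamma> t, inv_chart c (y t))) -` {z. \<exists>p. z = (p, p)})"
    by (intro continuous_closed_preimage continuous_on_Pair \<gamma> closed_diagonal) auto
  then have "closed C"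
    by (rule back_subst[of closed]) (auto simp: C_def)
  moreover have "continuous_on C (\<lambda>t. \<gamma>' t c - w t)"
  proof -
    have "continuous (at t within {0..1}) (\<lambda>t. \<gamma>' t c)" if "t \<in> C" for t
      using geodesic_chart_derivatives(2)[OF geo _ C_fst[OF that]] that
      by (auto simp: C_def intro: has_vector_derivative_continuous)
    then have "continuous_on C (\<lambda>t. \<gamma>' t c)"
      unfolding continuous_on_eq_continuous_within
      using continuous_within_subset[OF _ C_sub] by blast
    moreover have "continuous_on C w"
      using cont_w by (rule continuous_on_subset) (auto simp: C_def)
    ultimately show ?thesis by (rule continuous_on_diff)
  qed
  ultimately have "closed (C \<inter> (\<lambda>t. \<gamma>' t c - w t) -` {0})"
    by (intro continuous_closed_preimage) auto
  then have "closed E"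
    by (rule back_subst[of closed]) (auto simp: E_def)
  then have closedin: "closedin (top_of_set {0..1}) E"
    by (intro closed_subset) (auto simp: E_def C_def)
  have openin: "openin (top_of_set {0..1}) E"
    unfolding openin_euclidean_subtopology_iff
  proof (intro conjI ballI)
    fix t0 assume "t0 \<in> E"
    then have t0: "t0 \<in> {0..1}" "\<gamma> t0 = inv_chart c (y t0)" "\<gamma>' t0 c = w t0" and "\<gamma> t0 \<in> fst c"
      using C_fst by (auto simp: E_def C_def)
    have "openin (top_of_set {0..1}) ({0..1} \<inter> \<gamma> -` fst c)"
      using \<gamma> open_fst[OF c_in_atlas] by (rule continuous_openin_preimage_gen)
    then obtain D where D: "open D" "{0..1} \<inter> \<gamma> -` fst c = {0..1} \<inter> D"
      unfolding openin_open by blast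
    define z1 z2 where "z1 t = (y t, w t)" and "z2 t = (snd c (\<gamma> t), \<gamma>' t c)" for t
    have "\<exists>d>0. \<forall>t\<in>{0..1}. dist t t0 < d \<longrightarrow> z1 t = z2 t"
    proof (rule ode_unique_near[where D = D and X = geodesic_field])
      show "t0 \<in> D" using D(2) t0(1) \<open>\<gamma> t0 \<in> fst c\<close> by blast
      show "(z1 has_vector_derivative geodesic_field (z1 t)) (at t within {0..1})" if "t \<in> {0..1} \<inter> D" for t
        unfolding z1_def[abs_def] geodesic_field_def fst_conv snd_conv
        using y that by (intro has_vector_derivative_Pair) auto
      show "(z2 has_vector_derivative geodesic_field (z2 t)) (at t within {0..1})" if "t \<in> {0..1} \<inter> D" for t
      proof -
        have t: "t \<in> {0..1}" "\<gamma> t \<in> fst c" using that D(2) by blast+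
        show ?thesis
          unfolding z2_def[abs_def] geodesic_field_def fst_conv snd_conv
          by (rule has_vector_derivative_Pair[OF geodesic_chart_derivatives[OF geo t]])
      qed
      show "z1 t0 = z2 t0"
        using t0 y(1) by (simp add: z1_def z2_def chart_inv_chart[OF c_in_atlas])
      show "lipschitz_near geodesic_field (z1 t0)"
        using y(1) t0(1) by (intro lipschitz_near_geodesic_field) (simp add: z1_def)
    qed (use D(1) t0(1) in auto)
    then obtain d where d: "d > 0" "\<And>t. t \<in> {0..1} \<Longrightarrow> dist t t0 < d \<Longrightarrow> z1 t = z2 t" by blast
    obtain d' where d': "d' > 0" "ball t0 d' \<subseteq> D"
      using D t0(1) \<open>\<gamma> t0 \<in> fst c\<close> openE[of D t0] by blast
    have "t \<in> E" if t: "t \<in> {0..1}" "dist t t0 < min d d'" for t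
    proof -
      have "t \<in> D" using t d'(2) by (auto simp: dist_commute)
      then have "\<gamma> t \<in> fst c" using t(1) D(2) by blast
      with d(2)[of t] t show ?thesis
        using inv_chart_chart[OF c_in_atlas, of "\<gamma> t"] by (auto simp: E_def C_def z1_def z2_def)
    qed
    then show "\<exists>e>0. \<forall>t\<in>{0..1}. dist t t0 < e \<longrightarrow> t \<in> E"
      using d(1) d'(1) by (intro exI[of _ "min d d'"]) auto
  qed (auto simp: E_def C_def)
  have "0 \<in> E" using init by (simp add: E_def C_def)
  with openin closedin have "E = {0..1}"
    using connected_Icc[of 0 "1::real"] unfolding connected_clopen by blast
  then have "t \<in> E" using t by (rule ssubst)
  then show ?thesis by (simp add: E_def C_def)
qed

end

locale normal_chart = riemannian_chart A g c
  for A :: "'m::{t2_space, second_countable_topology} chart set" and g :: "'m tensor" and c :: "'m chart" +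
  fixes x :: 'm and e :: "8 \<Rightarrow> 'm tvec"
  assumes normal: "normal_coordinates A g x e c"
begin

lemma x_in_chart: "x \<in> fst c" and chart_x: "snd c x = 0"
  using normal by (auto simp: normal_coordinates_def)

lemma zero_in_img: "0 \<in> img c"
  using chart_in_img[OF x_in_chart] chart_x by simp

lemma inv_chart_0: "inv_chart c 0 = x"
  using inv_chart_chart[OF c_in_atlas x_in_chart] chart_x by simp

lemma frame_in_tangent_space: "e i \<in> tangent_space A x"
  using normal by (auto simp: normal_coordinates_def orthonormal_frame_def is_frame_def)

lemma exp_exists:
  assumes "v \<in> img c"
  obtains \<gamma> \<gamma>' where "geodesic A g \<gamma> \<gamma>'" "\<gamma> 0 = x" "\<gamma>' 0 = lincomb e v" "\<gamma> 1 = inv_chart c v"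
  using normal assms by (auto simp: normal_coordinates_def is_exp_def)

lemma lincomb_scale: "lincomb e (s *\<^sub>R v) c = s *\<^sub>R lincomb e v c"
  by (simp add: lincomb_def scaleR_sum_right)

text \<open>Let \<open>\<gamma>\<close> be the geodesic that ends at the point with coordinates \<open>v\<close>, and let \<open>s\<close> be so small that
  \<open>\<gamma>\<close> has not left the chart up to time \<open>s\<close>. The geodesic that ends at the point with coordinates
  \<open>s *\<^sub>R v\<close> agrees with \<open>t \<mapsto> \<gamma> (s * t)\<close>, and the two end points show that \<open>\<gamma> s\<close> has
  coordinates \<open>s *\<^sub>R v\<close>. The image of the chart may fail to be star-shaped, which is why the claim
  is restricted to small times.\<close>

lemma radial_geodesic:
  assumes v: "v \<in> img c"
  obtains \<gamma> \<gamma>' d where "geodesic A g \<gamma> \<gamma>'" "\<gamma>' 0 = lincomb e v" "0 < d" "d \<le> 1"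
    "\<And>t. t \<in> {0..d} \<Longrightarrow> \<gamma> t \<in> fst c" "\<And>t. t \<in> {0..d} \<Longrightarrow> snd c (\<gamma> t) = t *\<^sub>R v"
proof -
  obtain \<gamma> \<gamma>' where \<gamma>: "geodesic A g \<gamma> \<gamma>'" "\<gamma> 0 = x" "\<gamma>' 0 = lincomb e v"
    using exp_exists[OF v] by blast
  have "openin (top_of_set {0..1}) ({0..1} \<inter> \<gamma> -` fst c)"
    using \<gamma>(1) open_fst[OF c_in_atlas] by (intro continuous_openin_preimage_gen) (auto simp: geodesic_def)
  then obtain d1 where d1: "d1 > 0" "\<And>t. t \<in> {0..1} \<Longrightarrow> dist t 0 < d1 \<Longrightarrow> \<gamma> t \<in> fst c"
  proof -
    have "0 \<in> {0..1} \<inter> \<gamma> -` fst c" using \<gamma>(2) x_in_chart by simp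
    with \<open>openin _ _\<close> have "\<exists>d>0. \<forall>t\<in>{0..1}. dist t 0 < d \<longrightarrow> t \<in> {0..1} \<inter> \<gamma> -` fst c"
      unfolding openin_euclidean_subtopology_iff by blast
    then show ?thesis using that by blast
  qed
  have "0 \<in> (\<lambda>t::real. t *\<^sub>R v) -` img c" by (simp add: zero_in_img)
  moreover have "open ((\<lambda>t::real. t *\<^sub>R v) -` img c)"
    by (rule open_vimage[OF open_chart_img]) (intro continuous_intros)
  ultimately obtain d2 where d2: "d2 > 0" "ball 0 d2 \<subseteq> (\<lambda>t::real. t *\<^sub>R v) -` img c"
    using openE by blast
  define d where "d = min 1 (min d1 d2) / 2"
  have d: "0 < d" "d \<le> 1" "d < d1" "d < d2"
    using d1(1) d2(1) by (auto simp: d_def)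
  have in_c: "\<gamma> t \<in> fst c" if "t \<in> {0..d}" for t
    using that d d1(2)[of t] by auto
  have "snd c (\<gamma> s) = s *\<^sub>R v" if s: "s \<in> {0..d}" for s
  proof -
    have sv: "s *\<^sub>R v \<in> img c" using s d subsetD[OF d2(2), of s] by auto
    then obtain \<beta> \<beta>' where \<beta>: "geodesic A g \<beta> \<beta>'" "\<beta> 0 = x" "\<beta>' 0 = lincomb e (s *\<^sub>R v)"
        "\<beta> 1 = inv_chart c (s *\<^sub>R v)"
      using exp_exists by blast
    let ?y = "\<lambda>t. snd c (\<gamma> (s * t))" and ?w = "\<lambda>t. s *\<^sub>R \<gamma>' (s * t) c"
    have st: "s * t \<in> {0..d}" "s * t \<in> {0..1}" if "t \<in> {0..1}" for t
      using that s d mult_left_le[of t s] by auto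
    have sub: "(\<lambda>t. s * t) ` {0..1} \<subseteq> {0..1}" using st(2) by blast
    have comp: "((\<lambda>t. f (s * t)) has_vector_derivative s *\<^sub>R f') (at t within {0..1})"
      if "(f has_vector_derivative f') (at (s * t) within {0..1})"
      for f :: "real \<Rightarrow> real^8" and f' t
    proof -
      have "((\<lambda>t. s * t) has_vector_derivative s) (at t within {0..1})"
        by (auto intro!: derivative_eq_intros)
      from vector_diff_chain_within[OF this has_vector_derivative_within_subset[OF that sub]]
      show ?thesis by (simp add: o_def)
    qed
    have acc: "acceleration u (s *\<^sub>R w) = s *\<^sub>R s *\<^sub>R acceleration u w" for u w
      by (simp add: acceleration_def vec_eq_iff sum_distrib_left mult_ac)
    have "\<beta> 1 = inv_chart c (?y 1)"
    proof (rule geodesic_determined_in_chart[OF \<beta>(1), where w = ?w])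
      fix t :: real assume t: "t \<in> {0..1}"
      note der = geodesic_chart_derivatives[OF \<gamma>(1) st(2)[OF t] in_c[OF st(1)[OF t]]]
      show "?y t \<in> img c" using in_c[OF st(1)[OF t]] by (rule chart_in_img)
      show "(?y has_vector_derivative ?w t) (at t within {0..1})"
        by (rule comp[OF der(1)])
      show "(?w has_vector_derivative acceleration (?y t) (?w t)) (at t within {0..1})"
        unfolding acc
        by (rule bounded_linear.has_vector_derivative[OF bounded_linear_scaleR_right comp[OF der(2)]])
    qed (simp_all add: \<beta> \<gamma> chart_x inv_chart_0 lincomb_scale)
    then have "inv_chart c (s *\<^sub>R v) = \<gamma> s"
      using \<beta>(4) inv_chart_chart[OF c_in_atlas in_c[OF s]] by simp
    then show ?thesis using chart_inv_chart[OF c_in_atlas sv] by simp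
  qed
  with that[OF \<gamma>(1,3) d(1,2) in_c] show thesis by blast
qed

text \<open>The curve $t \mapsto tv$ has velocity $v$ and no acceleration, so both are read off from the
  geodesic equation. The derivatives are taken within a closed interval because at time 0 only
  one side is available.\<close>

lemma straight_lines:
  assumes v: "v \<in> img c"
  shows "lincomb e v c = v" "\<exists>d>0. \<forall>t\<in>{0..d}. acceleration (t *\<^sub>R v) v = 0"
proof -
  obtain \<gamma> \<gamma>' d where \<gamma>: "geodesic A g \<gamma> \<gamma>'" "\<gamma>' 0 = lincomb e v" and d: "0 < d" "d \<le> 1"
    and in_c: "\<And>t. t \<in> {0..d} \<Longrightarrow> \<gamma> t \<in> fst c" and line: "\<And>t. t \<in> {0..d} \<Longrightarrow> snd c (\<gamma> t) = t *\<^sub>R v"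
    using radial_geodesic[OF v] by metis
  have within: "((\<lambda>s. snd c (\<gamma> s)) has_vector_derivative \<gamma>' t c) (at t within {0..d})"
      "((\<lambda>s. \<gamma>' s c) has_vector_derivative acceleration (snd c (\<gamma> t)) (\<gamma>' t c)) (at t within {0..d})"
    if "t \<in> {0..d}" for t
    using geodesic_chart_derivatives[OF \<gamma>(1) _ in_c[OF that]] that d
    by (auto intro: has_vector_derivative_within_subset)
  have vel: "\<gamma>' t c = v" if t: "t \<in> {0..d}" for t
  proof (rule vector_derivative_unique_within_closed_interval[of 0 d, unfolded cbox_interval, OF d(1) t within(1)[OF t]])
    have "((\<lambda>s. s *\<^sub>R v) has_vector_derivative v) (at t within {0..d})"
      by (auto intro!: derivative_eq_intros)
    then show "((\<lambda>s. snd c (\<gamma> s)) has_vector_derivative v) (at t within {0..d})"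
      by (rule has_vector_derivative_transform[OF t _ , rotated]) (use line in auto)
  qed
  show "lincomb e v c = v" using vel[of 0] d(1) \<gamma>(2) by simp
  have "acceleration (t *\<^sub>R v) v = 0" if t: "t \<in> {0..d}" for t
  proof (rule vector_derivative_unique_within_closed_interval[of 0 d, unfolded cbox_interval, OF d(1) t])
    show "((\<lambda>s. \<gamma>' s c) has_vector_derivative acceleration (t *\<^sub>R v) v) (at t within {0..d})"
      using within(2)[OF t] vel[OF t] line[OF t] by simp
    show "((\<lambda>s. \<gamma>' s c) has_vector_derivative 0) (at t within {0..d})"
      by (rule has_vector_derivative_transform[OF t _ has_vector_derivative_const[of v]])
         (use vel in auto)
  qed
  then show "\<exists>d>0. \<forall>t\<in>{0..d}. acceleration (t *\<^sub>R v) v = 0" using d(1) by blast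
qed

end


section \<open>Christoffel symbols and curvature at the centre\<close>

lemma sum_axis: "(\<Sum>q\<in>UNIV. f q * axis i (1::real) $ q) = f i"
  by (simp add: axis_def if_distrib[of "\<lambda>z. _ * z"] cong: if_cong)

text \<open>Polarization with two standard basis vectors.\<close>

lemma quadratic_form_eq_0:
  fixes B :: "'n::finite \<Rightarrow> 'n \<Rightarrow> real"
  assumes sym: "\<And>i j. B i j = B j i"
    and zero: "\<And>u :: real^'n. (\<Sum>i\<in>UNIV. \<Sum>j\<in>UNIV. B i j * u $ i * u $ j) = 0"
  shows "B i j = 0"
proof -
  define q where "q u w = (\<Sum>i\<in>UNIV. (\<Sum>j\<in>UNIV. B i j * w $ j) * u $ i)" for u w :: "real^'n"
  have q0: "q u u = 0" for u
    using zero[of u] by (simp add: q_def sum_distrib_left sum_distrib_right mult_ac)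
  have add: "q (u + w) (u + w) = q u u + q u w + q w u + q w w" for u w
    by (simp add: q_def sum.distrib distrib_left distrib_right)
  have q_axis: "q (axis a 1) (axis b 1) = B a b" for a b
    by (simp add: q_def sum_axis)
  show ?thesis
    using add[of "axis i 1" "axis j 1"] sym[of i j] unfolding q0 q_axis by simp
qed

text \<open>This is the polarized identity \<open>T(w,u,u) + T(u,w,u) + T(u,u,w) = 0\<close> of a cubic form that
  vanishes identically, with \<open>w\<close> a standard basis vector and the symmetry in the last two
  arguments used to merge two terms.\<close>

lemma cubic_form_polarization:
  fixes G :: "'n::finite \<Rightarrow> 'n \<Rightarrow> 'n \<Rightarrow> real"
  assumes sym: "\<And>p i j. G p i j = G p j i"
    and zero: "\<And>u :: real^'n. (\<Sum>p\<in>UNIV. \<Sum>i\<in>UNIV. \<Sum>j\<in>UNIV. G p i j * u $ p * u $ i * u $ j) = 0"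
  shows "(\<Sum>p\<in>UNIV. \<Sum>q\<in>UNIV. G i p q * u $ p * u $ q)
       = - 2 * (\<Sum>p\<in>UNIV. \<Sum>q\<in>UNIV. G p i q * u $ p * u $ q)"
proof -
  define T where "T a b d = (\<Sum>p\<in>UNIV. (\<Sum>i\<in>UNIV. (\<Sum>j\<in>UNIV. G p i j * d $ j) * b $ i) * a $ p)"
    for a b d :: "real^'n"
  have T0: "T u u u = 0" for u
    using zero[of u] by (simp add: T_def sum_distrib_left sum_distrib_right mult_ac)
  have plus: "T (u + w) (u + w) (u + w)
      = T u u u + T u u w + T u w u + T w u u + T u w w + T w u w + T w w u + T w w w" for u w
    by (simp add: T_def sum.distrib distrib_left distrib_right)
  have minus: "T (u - w) (u - w) (u - w)
      = T u u u - T u u w - T u w u - T w u u + T u w w + T w u w + T w w u - T w w w" for u w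
    by (simp add: T_def sum_subtractf left_diff_distrib right_diff_distrib)
  let ?w = "axis i 1 :: real^'n"
  have "T u u ?w = T u ?w u"
  proof -
    have "T u u ?w = (\<Sum>p\<in>UNIV. (\<Sum>q\<in>UNIV. G p q i * u $ q) * u $ p)"
      by (simp add: T_def sum_axis)
    also have "\<dots> = (\<Sum>p\<in>UNIV. (\<Sum>q\<in>UNIV. G p i q * u $ q) * u $ p)"
      by (simp only: sym[of _ _ i])
    also have "\<dots> = T u ?w u" by (simp add: T_def sum_axis)
    finally show ?thesis .
  qed
  then have "T ?w u u = - 2 * T u ?w u"
    \<comment> \<open>the difference of the two expansions isolates the terms of odd degree in the basis vector\<close>
    using plus[of u ?w] minus[of u ?w] unfolding T0 by simp
  moreover have "T ?w u u = (\<Sum>p\<in>UNIV. \<Sum>q\<in>UNIV. G i p q * u $ p * u $ q)"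
    unfolding T_def sum_axis by (simp add: sum_distrib_left mult_ac)
  moreover have "T u ?w u = (\<Sum>p\<in>UNIV. \<Sum>q\<in>UNIV. G p i q * u $ p * u $ q)"
    unfolding T_def sum_axis by (simp add: sum_distrib_left mult_ac)
  ultimately show ?thesis by simp
qed

context normal_chart
begin

text \<open>Both claims hold for small multiples of \<open>u\<close> and are homogeneous in \<open>u\<close>.\<close>

lemma lincomb_frame: "lincomb e u c = u"
  and acceleration_radial: "\<exists>d>0. \<forall>t\<in>{0..d}. acceleration (t *\<^sub>R u) u = 0"
proof -
  have "0 \<in> (\<lambda>t::real. t *\<^sub>R u) -` img c" by (simp add: zero_in_img)
  moreover have "open ((\<lambda>t::real. t *\<^sub>R u) -` img c)"
    by (rule open_vimage[OF open_chart_img]) (intro continuous_intros)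
  ultimately obtain r where r: "r > 0" "ball 0 r \<subseteq> (\<lambda>t::real. t *\<^sub>R u) -` img c"
    using openE by blast
  define s where "s = r / 2"
  have s: "s > 0" "s *\<^sub>R u \<in> img c"
    using r(1) subsetD[OF r(2), of s] by (simp_all add: s_def)
  note straight = straight_lines[OF s(2)]
  show "lincomb e u c = u" using straight(1) s(1) by (simp add: lincomb_scale)
  obtain d where d: "d > 0" "\<And>t. t \<in> {0..d} \<Longrightarrow> acceleration (t *\<^sub>R s *\<^sub>R u) (s *\<^sub>R u) = 0"
    using straight(2) by blast
  have "acceleration (t *\<^sub>R u) u = 0" if "t \<in> {0..d * s}" for t
  proof -
    have "acceleration ((t / s) *\<^sub>R s *\<^sub>R u) (s *\<^sub>R u) = 0"
      using that s(1) by (intro d(2)) (simp add: field_simps)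
    moreover have "acceleration y (s *\<^sub>R u) = (s * s) *\<^sub>R acceleration y u" for y
      by (simp add: acceleration_def vec_eq_iff sum_distrib_left mult_ac)
    ultimately show ?thesis using s(1) by simp
  qed
  then show "\<exists>d>0. \<forall>t\<in>{0..d}. acceleration (t *\<^sub>R u) u = 0"
    using d(1) s(1) by (intro exI[of _ "d * s"]) simp
qed

text \<open>A tangent vector is determined by its components in one chart.\<close>

lemma frame_eq_coord_vec: "e i = coord_vec A c x i"
proof
  fix c'
  have "e i c = lincomb e (axis i 1) c"
    by (simp add: lincomb_def axis_def if_distrib[of "\<lambda>z. z *\<^sub>R _"] cong: if_cong)
  then have ec: "e i c = axis i 1" by (simp only: lincomb_frame)
  show "e i c' = coord_vec A c x i c'"
  proof (cases "c' \<in> A \<and> x \<in> fst c'")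
    case True
    then have "e i c' = frechet_derivative (transition c c') (at (snd c x)) (e i c)"
      using frame_in_tangent_space[of i] c_in_atlas x_in_chart unfolding tangent_space_def by blast
    then show ?thesis using True by (simp add: coord_vec_def ec)
  next
    case False
    then have "e i c' = 0"
      using frame_in_tangent_space[of i] unfolding tangent_space_def by blast
    then show ?thesis using False by (auto simp: coord_vec_def)
  qed
qed

lemma gram_0: "gram i j 0 = (if i = j then 1 else 0)"
proof -
  have "gram i j 0 = g x [e i, e j]"
    by (simp add: tcomp_def inv_chart_0 frame_eq_coord_vec)
  then show ?thesis
    using normal by (simp add: normal_coordinates_def orthonormal_frame_def)
qed

lemma ginv_0: "ginv A g c i j 0 = (if i = j then 1 else 0)"
  using ginv_gram[OF zero_in_img, of i j] by (simp add: gram_0 if_distrib[of "\<lambda>z. z * _"] cong: if_cong)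

lemma differentiable_christoffel: "v \<in> img c \<Longrightarrow> \<Gamma> k i j differentiable (at v)"
  using smooth_christoffel open_chart_img by (rule smooth_on_imp_differentiable)

lemma differentiable_gram: "v \<in> img c \<Longrightarrow> gram i j differentiable (at v)"
  using smooth_gram open_chart_img by (rule smooth_on_imp_differentiable)

lemma differentiable_ginv: "v \<in> img c \<Longrightarrow> ginv A g c i j differentiable (at v)"
  using smooth_ginv open_chart_img by (rule smooth_on_imp_differentiable)

lemma christoffel_radial:
  "\<exists>d>0. \<forall>t\<in>{0..d}. (\<Sum>i\<in>UNIV. \<Sum>j\<in>UNIV. \<Gamma> k i j (t *\<^sub>R u) * u $ i * u $ j) = 0"
  using acceleration_radial[of u] by (simp add: acceleration_def vec_eq_iff) blast

lemma christoffel_0: "\<Gamma> k i j 0 = 0"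
proof (rule quadratic_form_eq_0)
  show "\<Gamma> k i j 0 = \<Gamma> k j i 0" for i j
    by (rule christoffel_commute[OF zero_in_img])
  show "(\<Sum>i\<in>UNIV. \<Sum>j\<in>UNIV. \<Gamma> k i j 0 * u $ i * u $ j) = 0" for u
  proof -
    obtain d where "d > 0" "\<forall>t\<in>{0..d}. (\<Sum>i\<in>UNIV. \<Sum>j\<in>UNIV. \<Gamma> k i j (t *\<^sub>R u) * u $ i * u $ j) = 0"
      using christoffel_radial by blast
    then show ?thesis by (auto dest: bspec[of _ _ 0])
  qed
qed

lemma pd_christoffel_commute: "pd p (\<Gamma> k i j) 0 = pd p (\<Gamma> k j i) 0"
  using open_chart_img zero_in_img christoffel_commute by (rule pd_cong_open)

text \<open>The function $t \mapsto \Gamma^k_{ij}(tu)\, u_i u_j$ vanishes for small $t \geq 0$, and this is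
  its derivative at 0.\<close>

lemma pd_christoffel_cubic:
  "(\<Sum>p\<in>UNIV. \<Sum>i\<in>UNIV. \<Sum>j\<in>UNIV. pd p (\<Gamma> k i j) 0 * u $ p * u $ i * u $ j) = 0"
proof -
  let ?h = "\<lambda>t. \<Sum>i\<in>UNIV. \<Sum>j\<in>UNIV. \<Gamma> k i j (t *\<^sub>R u) * u $ i * u $ j"
  let ?h' = "\<Sum>i\<in>UNIV. \<Sum>j\<in>UNIV. (\<Sum>p\<in>UNIV. u $ p * pd p (\<Gamma> k i j) (0 *\<^sub>R u)) * u $ i * u $ j"
  obtain d where d: "d > 0" "\<And>t. t \<in> {0..d} \<Longrightarrow> ?h t = 0"
    using christoffel_radial by blast
  have "(?h has_real_derivative ?h') (at 0)"
    by (intro DERIV_sum DERIV_cmult_right has_derivative_along_line differentiable_christoffel) (simp add: zero_in_img)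
  then have "(?h has_vector_derivative ?h') (at 0 within {0..d})"
    unfolding has_real_derivative_iff_has_vector_derivative by (rule has_vector_derivative_at_within)
  moreover have "(?h has_vector_derivative 0) (at 0 within {0..d})"
    by (rule has_vector_derivative_transform[OF _ _ has_vector_derivative_const[of 0]])
       (use d in auto)
  ultimately have "?h' = 0"
    using vector_derivative_unique_within_closed_interval[of 0 d 0 ?h ?h' 0, unfolded cbox_interval] d(1)
    by simp
  also have "?h' = (\<Sum>i\<in>UNIV. \<Sum>j\<in>UNIV. \<Sum>p\<in>UNIV. pd p (\<Gamma> k i j) 0 * u $ p * u $ i * u $ j)"
    by (simp add: sum_distrib_left sum_distrib_right mult_ac)
  also have "\<dots> = (\<Sum>i\<in>UNIV. \<Sum>p\<in>UNIV. \<Sum>j\<in>UNIV. pd p (\<Gamma> k i j) 0 * u $ p * u $ i * u $ j)"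
    by (intro sum.cong sum.swap refl)
  also have "\<dots> = (\<Sum>p\<in>UNIV. \<Sum>i\<in>UNIV. \<Sum>j\<in>UNIV. pd p (\<Gamma> k i j) 0 * u $ p * u $ i * u $ j)"
    by (rule sum.swap)
  finally show ?thesis .
qed

text \<open>With $\Gamma_{k,ij}$ the Christoffel symbols with lowered index,
  $\partial_k g_{ij} = \Gamma_{j,ki} + \Gamma_{i,kj}$.\<close>

lemma pd_gram_0: "pd k (gram i j) 0 = 0"
proof -
  let ?d = "\<lambda>k i j. pd k (gram i j) 0"
  have sym: "?d k i j = ?d k j i" for k i j
    using open_chart_img zero_in_img gram_commute by (rule pd_cong_open)
  have "?d i j k + ?d j i k - ?d k i j = 0" for i j k
    using christoffel_0[of k i j]
    by (simp add: christoffel_def ginv_0 if_distrib[of "\<lambda>z. z * _"] cong: if_cong)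
  from this[of k i j] this[of k j i] show ?thesis
    using sym[of k i j] sym[of i j k] sym[of j i k] by simp
qed

text \<open>Differentiate $g_{ib}\, g^{bj} = \delta_{ij}$ at the centre.\<close>

lemma pd_ginv_0: "pd k (ginv A g c i j) 0 = 0"
proof -
  have "pd k (\<lambda>v. \<Sum>b\<in>UNIV. gram i b v * ginv A g c b j v) 0 = pd k (\<lambda>v. if i = j then 1 else 0) 0"
    using open_chart_img zero_in_img ginv_gram by (rule pd_cong_open)
  moreover have "pd k (\<lambda>v. \<Sum>b\<in>UNIV. gram i b v * ginv A g c b j v) 0 = pd k (ginv A g c i j) 0"
    using differentiable_gram[OF zero_in_img] differentiable_ginv[OF zero_in_img]
    by (simp add: pd_sum pd_mult pd_gram_0 gram_0 if_distrib[of "\<lambda>z. z * _"] cong: if_cong)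
  ultimately show ?thesis by simp
qed

lemma riemann_0: "riemann A g c i j k l 0 = pd i (\<Gamma> l j k) 0 - pd j (\<Gamma> l i k) 0"
  by (simp add: riemann_def riemann_up_def christoffel_0 gram_0 if_distrib[of "\<lambda>z. _ * z"] cong: if_cong)

lemma cov_deriv_0: "cov_deriv A g c S m I 0 = pd m (S I) 0"
  by (simp add: cov_deriv_def christoffel_0)

text \<open>Polarization of the vanishing cubic form $\partial_p \Gamma^m_{ij}\, u_p u_i u_j$ gives
  $\partial_i \Gamma^m_{pq}\, u_p u_q = -2\, \partial_p \Gamma^m_{iq}\, u_p u_q$. So the second term
  of the curvature contributes twice the first one.\<close>

lemma riemann_quadratic:
  "(\<Sum>p\<in>UNIV. \<Sum>q\<in>UNIV. riemann A g c p i q m 0 * u $ p * u $ q)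
     = 3 * (\<Sum>p\<in>UNIV. \<Sum>q\<in>UNIV. pd p (\<Gamma> m q i) 0 * u $ p * u $ q)"
proof -
  have "(\<Sum>p\<in>UNIV. \<Sum>q\<in>UNIV. riemann A g c p i q m 0 * u $ p * u $ q)
      = (\<Sum>p\<in>UNIV. \<Sum>q\<in>UNIV. pd p (\<Gamma> m i q) 0 * u $ p * u $ q)
      - (\<Sum>p\<in>UNIV. \<Sum>q\<in>UNIV. pd i (\<Gamma> m p q) 0 * u $ p * u $ q)"
    by (simp add: riemann_0 left_diff_distrib sum_subtractf)
  also have "(\<Sum>p\<in>UNIV. \<Sum>q\<in>UNIV. pd i (\<Gamma> m p q) 0 * u $ p * u $ q)
      = - 2 * (\<Sum>p\<in>UNIV. \<Sum>q\<in>UNIV. pd p (\<Gamma> m i q) 0 * u $ p * u $ q)"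
    by (rule cubic_form_polarization[OF pd_christoffel_commute pd_christoffel_cubic])
  finally show ?thesis by (simp add: pd_christoffel_commute[of _ m _ i])
qed

lemma pd_cov_deriv_0:
  assumes "\<And>J. length J = length I \<Longrightarrow> smooth_on (img c) (S J)"
  shows "pd p (cov_deriv A g c S q I) 0 = pd p (pd q (S I)) 0
           - (\<Sum>k<length I. \<Sum>s\<in>UNIV. pd p (\<Gamma> s q (I ! k)) 0 * S (I[k := s]) 0)"
proof -
  have S: "S J differentiable (at 0)" "pd q (S J) differentiable (at 0)" if "length J = length I" for J q
    using assms[OF that] smooth_on_pd open_chart_img zero_in_img smooth_on_imp_differentiable by blast+
  note \<Gamma> = differentiable_christoffel[OF zero_in_img]
  have product: "pd p (\<lambda>v. \<Gamma> s q (I ! k) v * S (I[k := s]) v) 0 = pd p (\<Gamma> s q (I ! k)) 0 * S (I[k := s]) 0" for k s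
    by (simp add: pd_mult \<Gamma> S christoffel_0)
  have d: "(\<lambda>v. \<Gamma> s q (I ! k) v * S (I[k := s]) v) differentiable (at 0)" for k s
    by (intro differentiable_mult \<Gamma> S) simp
  show ?thesis
    unfolding cov_deriv_def[abs_def]
    by (subst pd_diff) (simp_all add: pd_sum d S product)
qed

end


section \<open>The derivatives of the form at the centre\<close>

text \<open>The derivation action of a matrix on a tensor of rank 4.\<close>

definition action ::
  "(8 \<Rightarrow> 8 \<Rightarrow> real) \<Rightarrow> (8 \<Rightarrow> 8 \<Rightarrow> 8 \<Rightarrow> 8 \<Rightarrow> real) \<Rightarrow> 8 \<Rightarrow> 8 \<Rightarrow> 8 \<Rightarrow> 8 \<Rightarrow> real" where
  "action W F i j k l =
     (\<Sum>m\<in>UNIV. W i m * F m j k l + W j m * F i m k l + W k m * F i j m l + W l m * F i j k m)"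

lemma action_scale: "action (\<lambda>i m. a * W i m) F i j k l = a * action W F i j k l"
  by (simp add: action_def sum_distrib_left distrib_left mult.assoc)

lemma action_add:
  "action (\<lambda>i m. W i m + W' i m) F i j k l = action W F i j k l + action W' F i j k l"
  by (simp add: action_def sum.distrib distrib_right)

lemma action_sum:
  assumes "finite I"
  shows "(\<Sum>a\<in>I. action (W a) F i j k l * u a) = action (\<lambda>i m. \<Sum>a\<in>I. W a i m * u a) F i j k l"
  using assms
proof induction
  case empty
  show ?case by (simp add: action_def)
next
  case (insert a I)
  then show ?case
    using action_scale[of "u a" "W a" F i j k l] by (simp add: action_add mult.commute)
qed

lemma action_quadratic:
  "(\<Sum>p\<in>UNIV. \<Sum>q\<in>UNIV. action (W p q) F i j k l * u $ p * u $ q)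
     = action (\<lambda>i m. \<Sum>p\<in>UNIV. \<Sum>q\<in>UNIV. W p q i m * u $ p * u $ q) F i j k l"
  for u :: "real^8"
proof -
  have "(\<Sum>p\<in>UNIV. \<Sum>q\<in>UNIV. action (W p q) F i j k l * u $ p * u $ q)
      = (\<Sum>p\<in>UNIV. \<Sum>q\<in>UNIV. action (W p q) F i j k l * (u $ p * u $ q))"
    by (simp add: mult.assoc)
  also have "\<dots> = (\<Sum>p\<in>UNIV. action (\<lambda>i m. \<Sum>q\<in>UNIV. W p q i m * (u $ p * u $ q)) F i j k l * 1)"
    by (simp add: action_sum)
  also have "\<dots> = action (\<lambda>i m. \<Sum>p\<in>UNIV. (\<Sum>q\<in>UNIV. W p q i m * (u $ p * u $ q)) * 1) F i j k l"
    by (rule action_sum) simp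
  finally show ?thesis by (simp add: mult.assoc)
qed

context normal_chart
begin

lemma contraction_0: "(\<Sum>a\<in>UNIV. \<Sum>b\<in>UNIV. ginv A g c a b 0 * E a b) = (\<Sum>a\<in>UNIV. E a a)"
  by (simp add: ginv_0 if_distrib[of "\<lambda>z. z * _"] cong: if_cong)

text \<open>To first order at the centre the inverse metric is the identity matrix.\<close>

lemma pd_contraction_0:
  assumes "\<And>a b. E a b differentiable (at 0)"
  shows "pd p (\<lambda>v. \<Sum>a\<in>UNIV. \<Sum>b\<in>UNIV. ginv A g c a b v * E a b v) 0 = (\<Sum>a\<in>UNIV. pd p (E a a) 0)"
proof -
  note ginv = differentiable_ginv[OF zero_in_img]
  have d: "(\<lambda>v. ginv A g c a b v * E a b v) differentiable (at 0)" for a b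
    by (intro differentiable_mult ginv assms)
  then have "(\<lambda>v. \<Sum>b\<in>UNIV. ginv A g c a b v * E a b v) differentiable (at 0)" for a
    by (intro differentiable_sum) auto
  then have "pd p (\<lambda>v. \<Sum>a\<in>UNIV. \<Sum>b\<in>UNIV. ginv A g c a b v * E a b v) 0
      = (\<Sum>a\<in>UNIV. \<Sum>b\<in>UNIV. pd p (\<lambda>v. ginv A g c a b v * E a b v) 0)"
    by (simp add: pd_sum d)
  also have "\<dots> = (\<Sum>a\<in>UNIV. \<Sum>b\<in>UNIV. ginv A g c a b 0 * pd p (E a b) 0)"
    by (simp add: pd_mult ginv assms pd_ginv_0)
  also have "\<dots> = (\<Sum>a\<in>UNIV. pd p (E a a) 0)" by (rule contraction_0)
  finally show ?thesis .
qed

end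

locale torsion_chart = normal_chart A g c x e
  for A :: "'m::{t2_space, second_countable_topology} chart set" and g :: "'m tensor" and c :: "'m chart"
    and x :: 'm and e :: "8 \<Rightarrow> 'm tvec" +
  fixes \<Phi> T :: "'m tensor"
  assumes smooth_form: "length I = 4 \<Longrightarrow> smooth_on (img c) (tcomp A \<Phi> c I)"
    and smooth_torsion: "length I = 3 \<Longrightarrow> smooth_on (img c) (tcomp A T c I)"
    and torsion: "v \<in> img c \<Longrightarrow> cov_deriv A g c (tcomp A \<Phi> c) m [i, j, k, l] v =
           (\<Sum>p\<in>UNIV. \<Sum>q\<in>UNIV. ginv A g c p q v *
             (tcomp A T c [m, i, p] v * tcomp A \<Phi> c [q, j, k, l] v +
              tcomp A T c [m, j, p] v * tcomp A \<Phi> c [i, q, k, l] v +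
              tcomp A T c [m, k, p] v * tcomp A \<Phi> c [i, j, q, l] v +
              tcomp A T c [m, l, p] v * tcomp A \<Phi> c [i, j, k, q] v))"
begin

abbreviation F :: "8 \<Rightarrow> 8 \<Rightarrow> 8 \<Rightarrow> 8 \<Rightarrow> real" where
  "F i j k l \<equiv> tcomp A \<Phi> c [i, j, k, l] 0"

abbreviation T0 :: "8 \<Rightarrow> 8 \<Rightarrow> 8 \<Rightarrow> real" where
  "T0 q a b \<equiv> tcomp A T c [q, a, b] 0"

abbreviation DT :: "8 \<Rightarrow> 8 \<Rightarrow> 8 \<Rightarrow> 8 \<Rightarrow> real" where
  "DT p q a b \<equiv> cov_deriv A g c (tcomp A T c) p [q, a, b] 0"

lemma pd_form_0: "pd q (tcomp A \<Phi> c [i, j, k, l]) 0 = action (T0 q) F i j k l"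
  using torsion[OF zero_in_img, of q i j k l] unfolding cov_deriv_0 contraction_0 action_def .

text \<open>The derivative at 0 of both sides of $\nabla_q \Phi = T_q \cdot \Phi$. On the right the product
  rule gives $\nabla_p T_q \cdot \Phi + T_q \cdot \partial_p \Phi$, and $\partial_p \Phi$ is
  $T_p \cdot \Phi$; on the left $\partial_p \partial_q \Phi$ is corrected by $\partial\Gamma \cdot \Phi$.\<close>

lemma pd_pd_form_0:
  "pd p (pd q (tcomp A \<Phi> c [i, j, k, l])) 0
     = action (DT p q) F i j k l + action (T0 q) (action (T0 p) F) i j k l
       + action (\<lambda>i s. pd p (\<Gamma> s q i) 0) F i j k l"
proof -
  have d\<Phi>: "tcomp A \<Phi> c [a, b, d, f] differentiable (at 0)" for a b d f
    using smooth_form open_chart_img zero_in_img by (intro smooth_on_imp_differentiable) auto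
  have dT: "tcomp A T c [a, b, d] differentiable (at 0)" for a b d
    using smooth_torsion open_chart_img zero_in_img by (intro smooth_on_imp_differentiable) auto
  have "pd p (cov_deriv A g c (tcomp A \<Phi> c) q [i, j, k, l]) 0
      = pd p (\<lambda>v. \<Sum>a\<in>UNIV. \<Sum>b\<in>UNIV. ginv A g c a b v *
             (tcomp A T c [q, i, a] v * tcomp A \<Phi> c [b, j, k, l] v +
              tcomp A T c [q, j, a] v * tcomp A \<Phi> c [i, b, k, l] v +
              tcomp A T c [q, k, a] v * tcomp A \<Phi> c [i, j, b, l] v +
              tcomp A T c [q, l, a] v * tcomp A \<Phi> c [i, j, k, b] v)) 0"
    using open_chart_img zero_in_img torsion by (rule pd_cong_open)
  also have "\<dots> = (\<Sum>a\<in>UNIV. pd p (\<lambda>v. tcomp A T c [q, i, a] v * tcomp A \<Phi> c [a, j, k, l] v +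
              tcomp A T c [q, j, a] v * tcomp A \<Phi> c [i, a, k, l] v +
              tcomp A T c [q, k, a] v * tcomp A \<Phi> c [i, j, a, l] v +
              tcomp A T c [q, l, a] v * tcomp A \<Phi> c [i, j, k, a] v) 0)"
    by (rule pd_contraction_0) (intro differentiable_add differentiable_mult dT d\<Phi>)
  also have "\<dots> = action (DT p q) F i j k l + action (T0 q) (action (T0 p) F) i j k l"
    by (simp add: pd_add pd_mult differentiable_add differentiable_mult dT d\<Phi> pd_form_0 cov_deriv_0
          action_def[of "\<lambda>a b. pd p (tcomp A T c [q, a, b]) 0"] action_def[of "T0 q"] sum.distrib)
  finally have "pd p (cov_deriv A g c (tcomp A \<Phi> c) q [i, j, k, l]) 0
      = action (DT p q) F i j k l + action (T0 q) (action (T0 p) F) i j k l" .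
  moreover have "pd p (cov_deriv A g c (tcomp A \<Phi> c) q [i, j, k, l]) 0
      = pd p (pd q (tcomp A \<Phi> c [i, j, k, l])) 0 - action (\<lambda>i s. pd p (\<Gamma> s q i) 0) F i j k l"
    by (subst pd_cov_deriv_0) (simp_all add: smooth_form action_def sum.distrib)
  ultimately show ?thesis by simp
qed

lemma curvature_part:
  "(\<Sum>p\<in>UNIV. \<Sum>q\<in>UNIV. action (\<lambda>i s. pd p (\<Gamma> s q i) 0) F i j k l * u $ p * u $ q)
     = 1/3 * (\<Sum>p\<in>UNIV. \<Sum>q\<in>UNIV. action (\<lambda>i m. riemann A g c p i q m 0) F i j k l * u $ p * u $ q)"
  unfolding action_quadratic riemann_quadratic action_scale by simp

text \<open>The curvature can replace the derivatives of the Christoffel symbols only after the contraction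
  with \<open>v\<close>: without it, the derivatives and a third of the curvature differ by a term that is
  antisymmetric in \<open>p\<close> and \<open>q\<close>.\<close>

lemma form_expansion:
  "(\<lambda>v. tcomp A \<Phi> c [i, j, k, l] v -
      (F i j k l + (\<Sum>q\<in>UNIV. action (T0 q) F i j k l * v $ q)
       + (\<Sum>p\<in>UNIV. \<Sum>q\<in>UNIV.
            (1/2 * action (DT p q) F i j k l + 1/2 * action (T0 q) (action (T0 p) F) i j k l
             + 1/6 * action (\<lambda>i m. riemann A g c p i q m 0) F i j k l) * v $ p * v $ q)))
    \<in> O[nhds 0](\<lambda>v. norm v ^ 3)"
proof -
  let ?W = "\<lambda>p q. action (DT p q) F i j k l + action (T0 q) (action (T0 p) F) i j k l"
  let ?G = "\<lambda>p q. action (\<lambda>i s. pd p (\<Gamma> s q i) 0) F i j k l"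
  let ?R = "\<lambda>p q. action (\<lambda>i m. riemann A g c p i q m 0) F i j k l"
  have "(\<Sum>p\<in>UNIV. \<Sum>q\<in>UNIV. 1/2 * pd p (pd q (tcomp A \<Phi> c [i, j, k, l])) 0 * v $ p * v $ q)
      = (\<Sum>p\<in>UNIV. \<Sum>q\<in>UNIV.
            (1/2 * action (DT p q) F i j k l + 1/2 * action (T0 q) (action (T0 p) F) i j k l
             + 1/6 * ?R p q) * v $ p * v $ q)" (is "?lhs = ?rhs") for v
  proof -
    have "?lhs = (\<Sum>p\<in>UNIV. \<Sum>q\<in>UNIV. 1/2 * (?W p q * v $ p * v $ q))
               + 1/2 * (\<Sum>p\<in>UNIV. \<Sum>q\<in>UNIV. ?G p q * v $ p * v $ q)"
      unfolding pd_pd_form_0 sum_distrib_left sum.distrib[symmetric]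
      by (intro sum.cong refl) (simp add: algebra_simps)
    also have "\<dots> = (\<Sum>p\<in>UNIV. \<Sum>q\<in>UNIV. 1/2 * (?W p q * v $ p * v $ q))
               + 1/6 * (\<Sum>p\<in>UNIV. \<Sum>q\<in>UNIV. ?R p q * v $ p * v $ q)"
      unfolding curvature_part by simp
    also have "\<dots> = ?rhs"
      unfolding sum_distrib_left sum.distrib[symmetric]
      by (intro sum.cong refl) (simp add: algebra_simps)
    finally show ?thesis .
  qed
  then show ?thesis
    using smooth_taylor_2[OF smooth_form open_chart_img zero_in_img, of "[i, j, k, l]"]
    by (simp add: pd_form_0)
qed

end

section \<open>The expansion of the Cayley form\<close>

theorem theorem7p1:
  fixes A :: "'m::{t2_space, second_countable_topology} chart set"
    and \<Phi> g T :: "'m tensor" and x :: 'm and c :: "'m chart"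
  assumes "smooth_structure A"
    and "spin7_structure A \<Phi>"
    and "spin7_metric A \<Phi> g"
    and "spin7_torsion A \<Phi> g T"
    and "spin7_normal_coordinates A \<Phi> g x c"
  shows "let
      F = (\<lambda>i j k l. tcomp A \<Phi> c [i, j, k, l] 0);
      T0 = (\<lambda>q a b. tcomp A T c [q, a, b] 0);
      DT = (\<lambda>p q a b. cov_deriv A g c (tcomp A T c) p [q, a, b] 0);
      R = (\<lambda>i j k l. riemann A g c i j k l 0);
      Q = (\<lambda>p q i j k l.
          1/2 * (\<Sum>m\<in>UNIV. DT p q i m * F m j k l + DT p q j m * F i m k l
                          + DT p q k m * F i j m l + DT p q l m * F i j k m)
        + 1/2 * (\<Sum>m\<in>UNIV. T0 q i m * (\<Sum>s\<in>UNIV.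
              T0 p m s * F s j k l + T0 p j s * F m s k l
            + T0 p k s * F m j s l + T0 p l s * F m j k s))
        + 1/2 * (\<Sum>m\<in>UNIV. T0 q j m * (\<Sum>s\<in>UNIV.
              T0 p i s * F s m k l + T0 p m s * F i s k l
            + T0 p k s * F i m s l + T0 p l s * F i m k s))
        + 1/2 * (\<Sum>m\<in>UNIV. T0 q k m * (\<Sum>s\<in>UNIV.
              T0 p i s * F s j m l + T0 p j s * F i s m l
            + T0 p m s * F i j s l + T0 p l s * F i j m s))
        + 1/2 * (\<Sum>m\<in>UNIV. T0 q l m * (\<Sum>s\<in>UNIV.
              T0 p i s * F s j k m + T0 p j s * F i s k m
            + T0 p k s * F i j s m + T0 p m s * F i j k s))
        + 1/6 * (\<Sum>m\<in>UNIV. R p i q m * F m j k l + R p j q m * F i m k l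
                          + R p k q m * F i j m l + R p l q m * F i j k m))
    in \<forall>i j k l.
      (\<lambda>v :: real^8. tcomp A \<Phi> c [i, j, k, l] v -
         (F i j k l
          + (\<Sum>q\<in>UNIV. (\<Sum>m\<in>UNIV. T0 q i m * F m j k l + T0 q j m * F i m k l
                                + T0 q k m * F i j m l + T0 q l m * F i j k m) * v $ q)
          + (\<Sum>p\<in>UNIV. \<Sum>q\<in>UNIV. Q p q i j k l * v $ p * v $ q)))
      \<in> O[nhds 0](\<lambda>v. norm v ^ 3)"
proof -
  obtain e where e: "normal_coordinates A g x e c"
    using assms(5) by (auto simp: spin7_normal_coordinates_def)
  then have c: "c \<in> A" by (simp add: normal_coordinates_def)
  interpret torsion_chart A g c x e \<Phi> T
  proof
    show "smooth_structure A" "c \<in> A" "normal_coordinates A g x e c" by fact+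
    show "riemannian_metric A g" using assms(3) by (simp add: spin7_metric_def)
    show "smooth_on (img c) (tcomp A \<Phi> c I)" if "length I = 4" for I
      using assms(2) c that by (simp add: spin7_structure_def differential_form_def tensor_field_def)
    show "smooth_on (img c) (tcomp A T c I)" if "length I = 3" for I
      using assms(4) c that by (simp add: spin7_torsion_def tensor_field_def)
  qed (use assms(4) c in \<open>simp add: spin7_torsion_def\<close>)
  have quadratic: "1/2 * action (T0 q) F' i j k l
      = 1/2 * (\<Sum>m\<in>UNIV. T0 q i m * F' m j k l) + 1/2 * (\<Sum>m\<in>UNIV. T0 q j m * F' i m k l)
        + 1/2 * (\<Sum>m\<in>UNIV. T0 q k m * F' i j m l) + 1/2 * (\<Sum>m\<in>UNIV. T0 q l m * F' i j k m)"
    for q F' i j k l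
    by (simp add: action_def sum.distrib)
  show ?thesis
    unfolding Let_def
  proof (intro allI, goal_cases)
    case (1 i j k l)
    show ?case
      using form_expansion[of i j k l] unfolding quadratic unfolding action_def add.assoc .
  qed
qed

end
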